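(* Let $a>0$, $b>0$, and let $p(t,x)$ be the probability density function of the Variance Gamma process $X$ with parameters $a,b$. Then $$\frac{\partial}{\partial t} p(t,x) = -\left(\mathcal{D}_{a,\sqrt{b}}^{+}\,p(t,x) + \mathcal{D}_{a,\sqrt{b}}^{-}\,p(t,x)\right), \qquad t>0,\ x\in\mathbb{R},$$ with $p(0,x)=\delta(x)$, where the operators $\mathcal{D}^{\pm}_{a,\sqrt b}$ act on the variable $x$.
   Context: **Variance Gamma process.** Fix $a,b>0$. Let $H=\{H_t,t\ge 0\}$ be the Gamma subordinator started at $0$ with $\mathbf{E}[e^{-\lambda H_t}]=e^{-t\,a\ln(1+\lambda/b)}$ for $\lambda>0$; for $t>0$ its density is $h(t,s)=\frac{b^{at}}{\Gamma(at)}s^{at-1}e^{-bs}$ for $s>0$ and $h(t,s)=0$ for $s\le 0$. Let $B=\{B_t,t\ge0\}$ be a one-dimensional Brownian motion started at $0$, independent of $H$, with density $g(t,x)=e^{-x^2/(4t)}/\sqrt{4\pi t}$ (so $B_t$ has variance $2t$). The Variance Gamma process is $X_t=B_{H_t}$; its density is $p(t,x)=\int_0^\infty g(s,x)h(t,s)\,ds$ for $t>0$. $\delta$ is the Dirac delta at $0$. **Generalized Weyl derivatives.** For $\alpha,\beta>0$ let $\overline{\Pi}_{\alpha,\beta}(z)=\alpha\int_z^\infty \frac{e^{-\beta y}}{y}\,dy$, $z>0$ (the tail of the Lévy measure $\Pi_{\alpha,\beta}(dy)=\alpha\frac{e^{-\beta y}}{y}dy$ on $(0,\infty)$). For $x\in\mathbb{R}$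 define $$\mathcal{D}_{\alpha,\beta}^{+}u(x)=\frac{\partial}{\partial x}\int_{-\infty}^{x}u(s)\,\overline{\Pi}_{\alpha,\beta}(x-s)\,ds,\qquad \mathcal{D}_{\alpha,\beta}^{-}u(x)=-\frac{\partial}{\partial x}\int_{x}^{\infty}u(s)\,\overline{\Pi}_{\alpha,\beta}(s-x)\,ds,$$ respectively for functions $u$ such that $s\mapsto u(s)\overline{\Pi}_{\alpha,\beta}(x-s)\in L^1(-\infty,x)$ and $s\mapsto u(s)\overline{\Pi}_{\alpha,\beta}(s-x)\in L^1(x,\infty)$, for all $x\in\mathbb{R}$.
   Formalization: The equation is proved for all t>0 and x except x=0 with at≤1/2, where the density p(t,0) is infinite and its time derivative is undefined; the initial condition is read as X_0 having law δ and p(t,x)dx→δ weakly as t→0+. *)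

theory Defs
  imports "HOL-Probability.Probability"
begin

section \<open>Processes\<close>

text \<open>Processes are indexed by \<^term>\<open>t::real\<close>; only the values at \<open>t \<ge> 0\<close> matter. Path properties
  are required for every \<open>\<omega>\<close> in the sample space, so that \<open>B (H t \<omega>) \<omega>\<close> below is a genuine random
  variable without completing the probability space.\<close>

locale levy_process = prob_space M
  for M :: "'w measure" and Z :: "real \<Rightarrow> 'w \<Rightarrow> real" +
  assumes rv: "\<And>t. 0 \<le> t \<Longrightarrow> random_variable borel (Z t)"
    and start_0: "\<And>\<omega>. \<omega> \<in> space M \<Longrightarrow> Z 0 \<omega> = 0"
    and independent_increments:
      "\<And>(\<tau> :: nat \<Rightarrow> real) n. 0 \<le> \<tau> 0 \<Longrightarrow> incseq \<tau> \<Longrightarrow>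
         indep_vars (\<lambda>_. borel) (\<lambda>i \<omega>. Z (\<tau> (Suc i)) \<omega> - Z (\<tau> i) \<omega>) {..<n}"
    and stationary_increments:
      "\<And>s t. 0 \<le> s \<Longrightarrow> s \<le> t \<Longrightarrow> distr M borel (\<lambda>\<omega>. Z t \<omega> - Z s \<omega>) = distr M borel (Z (t - s))"
    and right_continuous:
      "\<And>\<omega> t. \<omega> \<in> space M \<Longrightarrow> 0 \<le> t \<Longrightarrow> continuous (at_right t) (\<lambda>s. Z s \<omega>)"
    and left_limits:
      "\<And>\<omega> t. \<omega> \<in> space M \<Longrightarrow> 0 < t \<Longrightarrow> \<exists>l. ((\<lambda>s. Z s \<omega>) \<longlongrightarrow> l) (at_left t)"

locale gamma_subordinator = levy_process M H
  for a b :: real and M :: "'w measure" and H :: "real \<Rightarrow> 'w \<Rightarrow> real" +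
  assumes nondecreasing: "\<And>\<omega>. \<omega> \<in> space M \<Longrightarrow> mono_on {0..} (\<lambda>t. H t \<omega>)"
    and laplace_transform:
      "\<And>l t. 0 < l \<Longrightarrow> 0 \<le> t \<Longrightarrow>
         expectation (\<lambda>\<omega>. exp (- l * H t \<omega>)) = exp (- t * (a * ln (1 + l / b)))"

text \<open>The generator convention is \<open>\<partial>\<^sup>2/\<partial>x\<^sup>2\<close>, not half of it: \<open>B t\<close> has variance \<open>2 t\<close>.\<close>

definition heat_kernel :: "real \<Rightarrow> real \<Rightarrow> real" where
  "heat_kernel t x = exp (- x\<^sup>2 / (4 * t)) / sqrt (4 * pi * t)"

locale brownian_motion = levy_process M B
  for M :: "'w measure" and B :: "real \<Rightarrow> 'w \<Rightarrow> real" +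
  assumes continuous_paths: "\<And>\<omega>. \<omega> \<in> space M \<Longrightarrow> continuous_on {0..} (\<lambda>t. B t \<omega>)"
    and gaussian: "\<And>t. 0 < t \<Longrightarrow> distributed M lborel (B t) (\<lambda>x. ennreal (heat_kernel t x))"

text \<open>Independence of the two processes is independence of the two path-valued random variables
  with respect to the product \<open>\<sigma>\<close>-algebra on \<open>\<real>\<^bsup>[0,\<infinity>)\<^esup>\<close>.\<close>

locale variance_gamma_process =
  H: gamma_subordinator a b M H + B: brownian_motion M B
  for a b :: real and M :: "'w measure" and H B X :: "real \<Rightarrow> 'w \<Rightarrow> real" +
  assumes independent:
      "prob_space.indep_var M
         (PiM {0..} (\<lambda>_. borel)) (\<lambda>\<omega>. \<lambda>t\<in>{0..}. H t \<omega>)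
         (PiM {0..} (\<lambda>_. borel)) (\<lambda>\<omega>. \<lambda>t\<in>{0..}. B t \<omega>)"
    and subordinated: "\<And>t \<omega>. 0 \<le> t \<Longrightarrow> \<omega> \<in> space M \<Longrightarrow> X t \<omega> = B (H t \<omega>) \<omega>"


section \<open>The density\<close>

definition gamma_subordinator_density :: "real \<Rightarrow> real \<Rightarrow> real \<Rightarrow> real \<Rightarrow> real" where
  "gamma_subordinator_density a b t s =
     (if 0 < s then b powr (a * t) / Gamma (a * t) * s powr (a * t - 1) * exp (- b * s) else 0)"

definition vg_density :: "real \<Rightarrow> real \<Rightarrow> real \<Rightarrow> real \<Rightarrow> real" where
  "vg_density a b t x =
     (LINT s:{0<..}|lborel. heat_kernel s x * gamma_subordinator_density a b t s)"

text \<open>The integrand above is nonnegative, so the mathematical value of the density at \<open>(t, x)\<close> is a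
  real number or \<open>\<infinity>\<close>; in the latter case the Bochner integral \<^const>\<open>vg_density\<close> returns the
  meaningless value 0. The lemma \<open>vg_density_finite_iff\<close> below shows that this happens exactly at
  \<open>x = 0\<close>, \<open>a t \<le> 1/2\<close>.\<close>

definition vg_density_finite :: "real \<Rightarrow> real \<Rightarrow> real \<Rightarrow> real \<Rightarrow> bool" where
  "vg_density_finite a b t x \<longleftrightarrow>
     set_integrable lborel {0<..} (\<lambda>s. heat_kernel s x * gamma_subordinator_density a b t s)"


section \<open>Generalized Weyl derivatives\<close>

definition levy_tail :: "real \<Rightarrow> real \<Rightarrow> real \<Rightarrow> real" where
  "levy_tail \<alpha> \<beta> z = \<alpha> * (LINT y:{z<..}|lborel. exp (- \<beta> * y) / y)"

definition weyl_domain_plus :: "real \<Rightarrow> real \<Rightarrow> (real \<Rightarrow> real) \<Rightarrow> bool" where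
  "weyl_domain_plus \<alpha> \<beta> u \<longleftrightarrow>
     (\<forall>x. set_integrable lborel {..<x} (\<lambda>s. u s * levy_tail \<alpha> \<beta> (x - s)))"

definition weyl_domain_minus :: "real \<Rightarrow> real \<Rightarrow> (real \<Rightarrow> real) \<Rightarrow> bool" where
  "weyl_domain_minus \<alpha> \<beta> u \<longleftrightarrow>
     (\<forall>x. set_integrable lborel {x<..} (\<lambda>s. u s * levy_tail \<alpha> \<beta> (s - x)))"

definition weyl_integral_plus :: "real \<Rightarrow> real \<Rightarrow> (real \<Rightarrow> real) \<Rightarrow> real \<Rightarrow> real" where
  "weyl_integral_plus \<alpha> \<beta> u x = (LINT s:{..<x}|lborel. u s * levy_tail \<alpha> \<beta> (x - s))"

definition weyl_integral_minus :: "real \<Rightarrow> real \<Rightarrow> (real \<Rightarrow> real) \<Rightarrow> real \<Rightarrow> real" where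
  "weyl_integral_minus \<alpha> \<beta> u x = (LINT s:{x<..}|lborel. u s * levy_tail \<alpha> \<beta> (s - x))"

text \<open>\<^const>\<open>deriv\<close> is total, so statements about the following operators have to assert
  differentiability of the integrals separately.\<close>

definition weyl_deriv_plus :: "real \<Rightarrow> real \<Rightarrow> (real \<Rightarrow> real) \<Rightarrow> real \<Rightarrow> real" where
  "weyl_deriv_plus \<alpha> \<beta> u x = deriv (weyl_integral_plus \<alpha> \<beta> u) x"

definition weyl_deriv_minus :: "real \<Rightarrow> real \<Rightarrow> (real \<Rightarrow> real) \<Rightarrow> real \<Rightarrow> real" where
  "weyl_deriv_minus \<alpha> \<beta> u x = - deriv (weyl_integral_minus \<alpha> \<beta> u) x"


section \<open>Where the density is finite\<close>

lemma set_integrable_gamma_kernel: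
  fixes z b :: real
  assumes "0 < z" "0 < b"
  shows "set_integrable lborel {0<..} (\<lambda>s. s powr (z - 1) * exp (- b * s))"
proof -
  have "((\<lambda>t. t powr (z - 1) / exp t) has_integral Gamma z) {0..}"
    using Gamma_integral_real[OF assms(1)] .
  then have "(\<lambda>t. t powr (z - 1) / exp t) absolutely_integrable_on {0..}"
    by (intro nonnegative_absolutely_integrable_1) auto
  then have "set_integrable lborel {0..} (\<lambda>t. t powr (z - 1) / exp t)"
    by (simp add: set_integrable_def integrable_completion)
  then have "integrable lborel (\<lambda>t. indicator {0<..} t * (t powr (z - 1) * exp (- t)))"
    unfolding set_integrable_def
    by (rule Bochner_Integration.integrable_cong[THEN iffD1, OF refl, rotated])
      (auto simp: indicator_def exp_minus field_simps)
  then have "integrable lborel (\<lambda>s. indicator {0<..} (0 + b * s) * ((0 + b * s) powr (z - 1) * exp (- (0 + b * s))))"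
    using assms by (intro lborel_integrable_real_affine) auto
  then have "integrable lborel (\<lambda>s. b powr (1 - z) * (indicator {0<..} (0 + b * s) * ((0 + b * s) powr (z - 1) * exp (- (0 + b * s)))))"
    by (rule integrable_mult_right)
  then show ?thesis
    unfolding set_integrable_def
    by (rule Bochner_Integration.integrable_cong[THEN iffD1, OF refl, rotated])
      (use assms in \<open>auto simp: indicator_def powr_mult powr_diff zero_less_mult_iff field_simps\<close>)
qed

lemma vg_integrand_eq:
  fixes a b t x s :: real
  assumes "0 < s"
  shows "heat_kernel s x * gamma_subordinator_density a b t s =
    b powr (a * t) / Gamma (a * t) / sqrt (4 * pi) *
      (exp (- x\<^sup>2 / (4 * s)) * (s powr (a * t - 1/2 - 1) * exp (- b * s)))"
proof -
  have "s powr (a * t - 1) = s powr (a * t - 1/2 - 1) * s powr (1/2)"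
    by (simp add: powr_add[symmetric])
  then have "s powr (a * t - 1) = s powr (a * t - 1/2 - 1) * sqrt s"
    using assms by (simp add: powr_half_sqrt)
  then show ?thesis
    using assms by (simp add: heat_kernel_def gamma_subordinator_density_def real_sqrt_mult mult_ac)
qed

lemma not_integrable_reciprocal:
  assumes "integrable lborel (\<lambda>s. indicator {0<..1} s * (1 / s) :: real)"
  shows False
proof -
  let ?f = "\<lambda>s. indicator {0<..1} s * (1 / s) :: real"
  have bound: "ln (1 / e) \<le> integral\<^sup>L lborel ?f" if "0 < e" "e < 1" for e :: real
  proof -
    have "((\<lambda>s. 1 / s) has_integral (ln 1 - ln e)) {e..1}"
      using that by (intro fundamental_theorem_of_calculus)
        (auto intro!: derivative_eq_intros simp: has_real_derivative_iff_has_vector_derivative[symmetric])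
    moreover have c: "continuous_on {e..1} (\<lambda>s. 1 / s :: real)"
      using that by (intro continuous_intros) auto
    ultimately have "(LINT s:{e..1}|lborel. 1 / s) = ln 1 - ln e"
      using set_borel_integral_eq_integral(2)[OF borel_integrable_atLeastAtMost'[OF c]]
      by (simp add: integral_unique)
    then have "ln (1 / e) = integral\<^sup>L lborel (\<lambda>s. indicator {e..1} s * (1 / s))"
      using that by (simp add: set_lebesgue_integral_def ln_div)
    also have "\<dots> \<le> integral\<^sup>L lborel ?f"
      using borel_integrable_atLeastAtMost'[OF c] that assms
      by (intro integral_mono) (auto simp: set_integrable_def indicator_def)
    finally show ?thesis .
  qed
  define K where "K = \<bar>integral\<^sup>L lborel ?f\<bar> + 1"
  have "ln (1 / exp (- K)) \<le> integral\<^sup>L lborel ?f"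
    by (rule bound) (auto simp: K_def)
  then show False
    by (simp add: ln_div) (simp add: K_def)
qed

lemma vg_density_finite_iff:
  fixes a b t x :: real
  assumes "0 < a" "0 < b" "0 < t"
  shows "vg_density_finite a b t x \<longleftrightarrow> x \<noteq> 0 \<or> 1/2 < a * t"
proof -
  define C where "C = b powr (a * t) / Gamma (a * t) / sqrt (4 * pi)"
  have at: "0 < a * t" using assms by simp
  have C: "0 < C" using assms at by (simp add: C_def Gamma_real_pos)
  let ?k = "\<lambda>s. exp (- x\<^sup>2 / (4 * s)) * (s powr (a * t - 1/2 - 1) * exp (- b * s))"
  have "vg_density_finite a b t x \<longleftrightarrow> set_integrable lborel {0<..} (\<lambda>s. C * ?k s)"
    unfolding vg_density_finite_def set_integrable_def
    by (intro Bochner_Integration.integrable_cong refl) (auto simp: indicator_def vg_integrand_eq C_def)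
  also have "\<dots> \<longleftrightarrow> set_integrable lborel {0<..} ?k"
    using C by simp
  also have "\<dots> \<longleftrightarrow> x \<noteq> 0 \<or> 1/2 < a * t"
  proof (cases "x = 0")
    case False
    have "set_integrable lborel {0<..} (\<lambda>s. 4 / x\<^sup>2 * (s powr ((a * t + 1/2) - 1) * exp (- b * s)))"
      using set_integrable_gamma_kernel[of "a * t + 1/2" b] at assms
      by (intro set_integrable_mult_right) auto
    then have "set_integrable lborel {0<..} ?k"
    proof (rule set_integrable_bound)
      show "set_borel_measurable lborel {0<..} ?k"
        unfolding set_borel_measurable_def by measurable
      show "AE s in lborel. s \<in> {0<..} \<longrightarrow>
          norm (?k s) \<le> norm (4 / x\<^sup>2 * (s powr ((a * t + 1/2) - 1) * exp (- b * s)))"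
      proof (intro AE_I2 impI)
        fix s :: real assume "s \<in> {0<..}"
        then have s: "0 < s" by simp
        define u where "u = x\<^sup>2 / (4 * s)"
        have u: "0 < u" using s False by (simp add: u_def)
        have "u \<le> exp u" using exp_ge_add_one_self[of u] by linarith
        then have "exp (- u) \<le> 1 / u" using u by (simp add: exp_minus field_simps)
        then have e: "exp (- x\<^sup>2 / (4 * s)) \<le> 4 / x\<^sup>2 * s"
          using s False by (simp add: u_def field_simps)
        have p: "s * s powr (a * t - 1/2 - 1) = s powr ((a * t + 1/2) - 1)"
          using s powr_add[of s 1 "a * t - 1/2 - 1"] by simp
        have "?k s \<le> (4 / x\<^sup>2 * s) * (s powr (a * t - 1/2 - 1) * exp (- b * s))"
          using e by (intro mult_right_mono) auto
        also have "\<dots> = 4 / x\<^sup>2 * ((s * s powr (a * t - 1/2 - 1)) * exp (- b * s))"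
          by simp
        finally have "?k s \<le> 4 / x\<^sup>2 * (s powr ((a * t + 1/2) - 1) * exp (- b * s))"
          unfolding p .
        then show "norm (?k s) \<le> norm (4 / x\<^sup>2 * (s powr ((a * t + 1/2) - 1) * exp (- b * s)))"
          by (simp add: abs_mult)
      qed
    qed
    with False show ?thesis by simp
  next
    case True
    show ?thesis
    proof (cases "1/2 < a * t")
      case True
      then show ?thesis
        using \<open>x = 0\<close> set_integrable_gamma_kernel[of "a * t - 1/2" b] assms by simp
    next
      case le: False
      have "\<not> set_integrable lborel {0<..} ?k"
      proof
        assume "set_integrable lborel {0<..} ?k"
        then have i: "integrable lborel (\<lambda>s. exp b * (indicator {0<..} s * ?k s))"
          unfolding set_integrable_def by simp
        have "integrable lborel (\<lambda>s. indicator {0<..1} s * (1 / s) :: real)"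
        proof (rule Bochner_Integration.integrable_bound[OF i])
          show "AE s in lborel. norm (indicator {0<..1} s * (1 / s) :: real)
              \<le> norm (exp b * (indicator {0<..} s * ?k s))"
          proof (intro AE_I2)
            fix s :: real
            show "norm (indicator {0<..1} s * (1 / s) :: real)
                \<le> norm (exp b * (indicator {0<..} s * ?k s))"
            proof (cases "0 < s \<and> s \<le> 1")
              case s: True
              have "s powr (-1) \<le> s powr (a * t - 1/2 - 1)"
                using s le by (intro powr_mono') auto
              moreover have "1 \<le> exp b * exp (- b * s)"
                using s assms by (simp add: exp_add[symmetric])
              ultimately have "s powr (-1) * 1 \<le> s powr (a * t - 1/2 - 1) * (exp b * exp (- b * s))"
                by (intro mult_mono) auto
              then show ?thesis
                using s \<open>x = 0\<close> by (simp add: powr_minus_divide abs_mult mult_ac)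
            qed (auto simp: indicator_def)
          qed
        qed measurable
        then show False by (rule not_integrable_reciprocal)
      qed
      with le \<open>x = 0\<close> show ?thesis by simp
    qed
  qed
  finally show ?thesis .
qed

end

(* The densities form a convolution semigroup: this is inherited from the heat kernel and, via the
   Beta integral, from the gamma densities. By the half-stable integral
     int_0^oo exp(-z^2/(4s) - b s) s^(-3/2) ds = 2 sqrt(pi) exp(-sqrt b |z|) / |z|,
   p(e,z)/e tends to a exp(-sqrt b |z|)/|z| as e decreases to 0, so dominated convergence in
     (p(t+e,x) - p(t,x)) / e = int (p(t,x-z) - p(t,x)) p(e,z)/e dz
   gives the right time derivative; that the two-sided derivative exists is read off the formula for p.
   The Weyl derivatives have the Marchaud form int_0^oo (p(t,x) - p(t,x-+z)) a exp(-sqrt b z)/z dz,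
   whence the equation. The law of X t is identified by its characteristic function: conditioning on
   H t gives E exp(i u X t) = E exp(-u^2 H t), which is the given Laplace transform at u^2. *)

theory Submission
  imports Defs
begin

section \<open>The kernel integral as a function of its exponent\<close>

text \<open>Up to an explicit factor the density is \<open>bessel_kernel b k x\<close> at
  \<open>k = a * t\<close>. The argument works with this whole family because \<open>k\<close> need
  not stay positive. At \<open>k = 0\<close> it is the half-stable integral, the source of the Levy
  density, and lowering \<open>k\<close> pays for the powers of 1/s that regularity in x costs. The
  factor \<open>1 / Gamma (a * e)\<close> vanishes like a e, which is why p(e,z)/e has a finite
  limit. The obstacle is the origin: p(t,.) is infinite there while a t <= 1/2, and even where it is
  finite it can have a kink. Hence the only regularity used is a Hoelder estimate at the single
  point x, which suffices against the singularity 1/|z| of the Levy density. The domination of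
  p(e,z)/e near e = 0 comes from \<open>s powr k <= 1 + s\<close> for k in [0,1]: the kernel at
  exponent a e is at most the sum of its values at 0 and 1. The first gives the Levy density again,
  the second a multiple of p(1/a,.), whose integral against p(t,x-z) - p(t,x) exists by the
  semigroup property.\<close>

lemma integral_dominated_convergence_at:
  fixes s :: "real \<Rightarrow> 'b \<Rightarrow> 'c::{banach, second_countable_topology}"
  assumes f: "f \<in> borel_measurable M"
    and s: "\<And>h. h \<in> A \<Longrightarrow> s h \<in> borel_measurable M"
    and w: "integrable M w"
    and lim: "AE x in M. ((\<lambda>h. s h x) \<longlongrightarrow> f x) (at y within A)"
    and bound: "\<And>h. h \<in> A \<Longrightarrow> AE x in M. norm (s h x) \<le> w x"
  shows "((\<lambda>h. integral\<^sup>L M (s h)) \<longlongrightarrow> integral\<^sup>L M f) (at y within A)"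
  unfolding tendsto_at_iff_sequentially comp_def
proof safe
  fix X :: "nat \<Rightarrow> real" assume X: "\<forall>i. X i \<in> A - {y}" "X \<longlonglongrightarrow> y"
  show "(\<lambda>n. integral\<^sup>L M (s (X n))) \<longlonglongrightarrow> integral\<^sup>L M f"
  proof (rule integral_dominated_convergence[where w = w])
    show "AE x in M. (\<lambda>i. s (X i) x) \<longlonglongrightarrow> f x"
      using lim X unfolding tendsto_at_iff_sequentially comp_def by (auto elim!: eventually_mono)
  qed (use f s w bound X in auto)
qed

text \<open>The integrand of \<open>vg_density\<close> without its constant factor, as in
  \<open>vg_integrand_eq\<close>, with \<open>a * t\<close> replaced by a free exponent that may be
  zero or negative.\<close>

definition vg_kernel :: "real \<Rightarrow> real \<Rightarrow> real \<Rightarrow> real \<Rightarrow> real" where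
  "vg_kernel b k x s = indicator {0<..} s * (exp (- x\<^sup>2 / (4 * s)) * (s powr (k - 1/2 - 1) * exp (- b * s)))"

text \<open>For b > 0 and x nonzero this is 2 (|x| / (2 sqrt b))^(k - 1/2) K_(k - 1/2)(sqrt b |x|),
  with K the modified Bessel function of the second kind. At \<open>x = 0\<close>,
  \<open>k <= 1/2\<close> the integral diverges and the value is the default 0.\<close>

definition bessel_kernel :: "real \<Rightarrow> real \<Rightarrow> real \<Rightarrow> real" where
  "bessel_kernel b k x = integral\<^sup>L lborel (vg_kernel b k x)"

lemma vg_kernel_nonneg [simp]: "0 \<le> vg_kernel b k x s"
  by (simp add: vg_kernel_def)

lemma vg_kernel_measurable [measurable]:
  "(\<lambda>(x, s). vg_kernel b k x s) \<in> borel_measurable (borel \<Otimes>\<^sub>M borel)"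
  "vg_kernel b k x \<in> borel_measurable borel"
  unfolding vg_kernel_def[abs_def] by measurable

lemma bessel_kernel_nonneg [simp]: "0 \<le> bessel_kernel b k x"
  by (simp add: bessel_kernel_def)

lemma bessel_kernel_measurable [measurable]: "bessel_kernel b k \<in> borel_measurable borel"
  unfolding bessel_kernel_def[abs_def] by measurable

lemma bessel_kernel_minus [simp]: "bessel_kernel b k (- x) = bessel_kernel b k x"
  by (simp add: bessel_kernel_def vg_kernel_def[abs_def])

lemma power2_powr_real: "x\<^sup>2 powr q = \<bar>x\<bar> powr (2 * q)" for x q :: real
proof (cases "x = 0")
  case False
  then have "x\<^sup>2 = \<bar>x\<bar> powr 2" by (simp add: powr_numeral)
  then show ?thesis by (metis powr_powr)
qed simp

text \<open>Raise \<open>u / q <= exp (u / q)\<close> to the power \<open>q\<close>. The best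
  constant would be (q/e)^q; the cruder one is enough.\<close>

lemma exp_minus_le_powr:
  fixes u :: real
  assumes "0 < q" "0 < u"
  shows "exp (- u) \<le> q powr q * u powr (- q)"
proof -
  have "u \<le> q * exp (u / q)"
    using exp_ge_add_one_self[of "u / q"] assms by (simp add: field_simps)
  then have "u powr q \<le> (q * exp (u / q)) powr q"
    using assms by (intro powr_mono2) auto
  also have "\<dots> = q powr q * exp u"
    using assms by (simp add: powr_mult exp_powr_real)
  finally show ?thesis
    using assms by (simp add: exp_minus powr_minus field_simps)
qed

text \<open>The Gaussian factor is traded for a power: \<open>exp_minus_le_powr\<close> at x^2 / (4
  s) yields \<open>s powr q\<close> at the price of \<open>\<bar>x\<bar> powr (- (2 * q))\<close>.
  This raises the exponent to k + q, and what remains is a gamma integrand, integrable once k + q >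
  1/2.\<close>

lemma vg_kernel_le:
  assumes "0 < q" "x \<noteq> 0"
  shows "vg_kernel b k x s \<le> (4 * q) powr q * \<bar>x\<bar> powr (- (2 * q))
           * (indicator {0<..} s * (s powr (k + q - 1/2 - 1) * exp (- b * s)))"
proof (cases "0 < s")
  case s: True
  have "exp (- (x\<^sup>2 / (4 * s))) \<le> q powr q * (x\<^sup>2 / (4 * s)) powr (- q)"
    using assms s by (intro exp_minus_le_powr) auto
  also have "(x\<^sup>2 / (4 * s)) powr (- q) = \<bar>x\<bar> powr (- (2 * q)) * (4 powr q * s powr q)"
    using s assms by (simp add: powr_divide powr_mult powr_minus power2_powr_real field_simps)
  finally have "exp (- (x\<^sup>2 / (4 * s))) \<le> (4 * q) powr q * \<bar>x\<bar> powr (- (2 * q)) * s powr q"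
    using assms by (simp add: powr_mult mult_ac)
  then have "exp (- (x\<^sup>2 / (4 * s))) * (s powr (k - 1/2 - 1) * exp (- b * s))
      \<le> (4 * q) powr q * \<bar>x\<bar> powr (- (2 * q)) * s powr q * (s powr (k - 1/2 - 1) * exp (- b * s))"
    by (intro mult_right_mono) auto
  also have "\<dots> = (4 * q) powr q * \<bar>x\<bar> powr (- (2 * q)) * (s powr (q + (k - 1/2 - 1)) * exp (- b * s))"
    unfolding powr_add by simp
  finally show ?thesis
    using s by (simp add: vg_kernel_def algebra_simps)
qed (simp add: vg_kernel_def)

lemma integrable_gamma_kernel:
  fixes z b :: real
  assumes "0 < z" "0 < b"
  shows "integrable lborel (\<lambda>s. indicator {0<..} s * (s powr (z - 1) * exp (- b * s)))"
  using set_integrable_gamma_kernel[OF assms] by (simp add: set_integrable_def)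

lemma vg_kernel_integrable:
  assumes "0 < b" "x \<noteq> 0 \<or> 1/2 < k"
  shows "integrable lborel (vg_kernel b k x)"
proof (cases "x = 0")
  case True
  then have "integrable lborel (\<lambda>s. indicator {0<..} s * (s powr ((k - 1/2) - 1) * exp (- b * s)))"
    using assms by (intro integrable_gamma_kernel) auto
  then show ?thesis
    by (rule Bochner_Integration.integrable_bound) (use True in \<open>auto simp: vg_kernel_def\<close>)
next
  case False
  \<comment> \<open>Any positive \<open>q\<close> with k + q > 1/2 would serve; this one works for
    every sign of \<open>k\<close>.\<close>
  define q where "q = \<bar>k\<bar> + 1"
  have q: "0 < q" "0 < k + q - 1/2" by (auto simp: q_def)
  show ?thesis
  proof (rule Bochner_Integration.integrable_bound)
    show "integrable lborel (\<lambda>s. (4 * q) powr q * \<bar>x\<bar> powr (- (2 * q))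
        * (indicator {0<..} s * (s powr (k + q - 1/2 - 1) * exp (- b * s))))"
      using integrable_gamma_kernel[OF q(2) assms(1)] by (rule integrable_mult_right)
    show "AE s in lborel. norm (vg_kernel b k x s) \<le> norm ((4 * q) powr q * \<bar>x\<bar> powr (- (2 * q))
        * (indicator {0<..} s * (s powr (k + q - 1/2 - 1) * exp (- b * s))))"
      using vg_kernel_le[OF q(1) False] by (auto intro!: AE_I2 simp: abs_mult)
  qed measurable
qed

text \<open>The integrated form of \<open>vg_kernel_le\<close>. With 2 q < 1 it says that the
  singularity at the origin is locally integrable, as the Weyl domains require.\<close>

lemma bessel_kernel_powr_bound:
  assumes "0 < b" "0 < q" "1/2 < k + q"
  obtains C where "0 \<le> C" "\<And>x. x \<noteq> 0 \<Longrightarrow> bessel_kernel b k x \<le> C * \<bar>x\<bar> powr (- (2 * q))"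
proof -
  define g where "g s = indicator {0<..} s * (s powr (k + q - 1/2 - 1) * exp (- b * s))" for s
  have g: "integrable lborel g"
    unfolding g_def using assms by (intro integrable_gamma_kernel) auto
  show thesis
  proof (rule that[of "(4 * q) powr q * integral\<^sup>L lborel g"])
    show "0 \<le> (4 * q) powr q * integral\<^sup>L lborel g"
      by (simp add: g_def)
    fix x :: real assume x: "x \<noteq> 0"
    have "bessel_kernel b k x \<le> integral\<^sup>L lborel (\<lambda>s. (4 * q) powr q * \<bar>x\<bar> powr (- (2 * q)) * g s)"
      unfolding bessel_kernel_def
    proof (rule integral_mono)
      show "vg_kernel b k x s \<le> (4 * q) powr q * \<bar>x\<bar> powr (- (2 * q)) * g s" for s
        unfolding g_def by (rule vg_kernel_le[OF assms(2) x])
    qed (use vg_kernel_integrable[of b x k] g assms x in auto)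
    then show "bessel_kernel b k x \<le> (4 * q) powr q * integral\<^sup>L lborel g * \<bar>x\<bar> powr (- (2 * q))"
      by (simp add: mult_ac)
  qed
qed

text \<open>\<open>s powr h\<close> is convex in \<open>h\<close>, so the slope of the chord from 0
  to h lies between (1 - s^(-d))/d and (s^d - 1)/d, the slopes of the chords over [-d,0] and [0,d].
  The bound does not depend on \<open>h\<close> and so dominates the difference quotients in the
  exponent.\<close>

lemma powr_difference_quotient_bound:
  fixes s h d :: real
  assumes s: "0 < s" and d: "\<bar>h\<bar> \<le> d" "h \<noteq> 0"
  shows "\<bar>(s powr h - 1) / h\<bar> \<le> (s powr d + s powr (- d)) / d"
proof -
  have d0: "0 < d" using d by linarith
  have key: "\<bar>s powr h - 1\<bar> / h \<le> (s powr d + s powr (- d)) / d"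
    if s: "0 < s" and h: "0 < h" "h \<le> d" for s h :: real
  proof -
    define g where "g x = s powr x" for x :: real
    have conv: "convex_on UNIV g"
    proof (rule convex_on_realI)
      show "\<And>x. (g has_real_derivative ln s * s powr x) (at x)"
        unfolding g_def using s by (auto intro!: derivative_eq_intros)
      show "\<And>x y. x \<le> y \<Longrightarrow> ln s * s powr x \<le> ln s * s powr y"
      proof -
        fix x y :: real assume "x \<le> y"
        show "ln s * s powr x \<le> ln s * s powr y"
        proof (cases "1 \<le> s")
          case True
          then show ?thesis using \<open>x \<le> y\<close> by (intro mult_left_mono powr_mono) auto
        next
          case False
          then show ?thesis using \<open>x \<le> y\<close> s by (intro mult_left_mono_neg powr_mono') auto
        qed
      qed
    qed auto
    have up: "g h \<le> (1 - h/d) * g 0 + (h/d) * g d"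
      using convex_onD[OF conv, of "h/d" 0 d] h by simp
    have dn: "g 0 \<le> (1 - d/(h+d)) * g (-d) + (d/(h+d)) * g h"
    proof -
      have "(1 - d/(h+d)) * (-d) + (d/(h+d)) * h = 0"
        using h by (simp add: field_simps)
      then show ?thesis
        using convex_onD[OF conv, of "d/(h+d)" "-d" h] h by simp
    qed
    have 1: "(g h - 1) / h \<le> g d / d"
    proof -
      have "g h - 1 \<le> h / d * (g d - 1)" using up s by (simp add: g_def algebra_simps)
      then have "(g h - 1) / h \<le> (g d - 1) / d" using h by (simp add: field_simps)
      also have "\<dots> \<le> g d / d" using h by (simp add: divide_right_mono)
      finally show ?thesis .
    qed
    have 2: "(1 - g h) / h \<le> g (-d) / d"
    proof -
      have "1 - d / (h + d) = h / (h + d)" using h by (simp add: field_simps)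
      then have "g 0 \<le> (h * g (-d) + d * g h) / (h + d)"
        using dn by (simp add: add_divide_distrib)
      then have "(h + d) * g 0 \<le> h * g (-d) + d * g h"
        using h by (simp add: pos_le_divide_eq mult_ac)
      then have "d * (1 - g h) \<le> h * (g (-d) - 1)" using s by (simp add: g_def algebra_simps)
      then have "(1 - g h) / h \<le> (g (-d) - 1) / d" using h by (simp add: field_simps)
      also have "\<dots> \<le> g (-d) / d" using h by (simp add: divide_right_mono)
      finally show ?thesis .
    qed
    have pos: "0 \<le> g d / d" "0 \<le> g (-d) / d" using h by (auto simp: g_def)
    show ?thesis
      using 1 2 pos unfolding g_def[symmetric] add_divide_distrib
      by (cases "g h \<ge> 1") auto
  qed
  show ?thesis
  proof (cases "0 < h")
    case True
    then show ?thesis using key[OF s, of h] d by (simp add: abs_mult)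
  next
    case False
    \<comment> \<open>A negative \<open>h\<close> is reduced to a positive one by passing from
      \<open>s\<close> to \<open>1 / s\<close>; the right-hand side is symmetric under this
      exchange.\<close>
    have "\<bar>(1 / s) powr (- h) - 1\<bar> / (- h) \<le> ((1 / s) powr d + (1 / s) powr (- d)) / d"
      using False d s by (intro key) auto
    moreover have "(1 / s) powr (- h) = s powr h" "(1 / s) powr d = s powr (- d)" "(1 / s) powr (- d) = s powr d"
      using s by (auto simp: powr_divide powr_minus inverse_eq_divide)
    ultimately show ?thesis using False d by (simp add: abs_mult add.commute)
  qed
qed

lemma vg_kernel_add:
  "vg_kernel b (k + h) x s = s powr h * vg_kernel b k x s"
proof (cases "0 < s")
  case True
  have "k + h - 1/2 - 1 = h + (k - 1/2 - 1)" by simp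
  then show ?thesis using True by (simp only: vg_kernel_def powr_add) (simp add: mult_ac)
qed (simp add: vg_kernel_def)

text \<open>Differentiation under the integral, dominated by the kernels with exponents k + d and k
  - d. Both have to be integrable, which limits \<open>d\<close> when x = 0. For x nonzero
  \<open>k = 0\<close> is allowed, and this gives the continuity needed for the small-time
  limit.\<close>

lemma bessel_kernel_differentiable:
  assumes b: "0 < b" and "x \<noteq> 0 \<or> 1/2 < k"
  obtains D where "((\<lambda>k. bessel_kernel b k x) has_real_derivative D) (at k)"
proof -
  \<comment> \<open>At the origin, \<open>d\<close> is half the distance of \<open>k\<close> from
    the threshold 1/2; elsewhere there is no threshold.\<close>
  obtain d where d: "0 < d" "x \<noteq> 0 \<or> 1/2 < k - d"
  proof (cases "x = 0")
    case True then show ?thesis using assms that[of "(k - 1/2) / 2"] by (auto simp: field_simps)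
  qed (use that[of 1] in auto)
  let ?w = "\<lambda>s. (vg_kernel b (k + d) x s + vg_kernel b (k + - d) x s) / d"
  let ?q = "\<lambda>h s. (vg_kernel b (k + h) x s - vg_kernel b k x s) / h"
  have qeq: "?q h s = (s powr h - 1) / h * vg_kernel b k x s" if "h \<noteq> 0" for h s
    unfolding vg_kernel_add by (simp add: left_diff_distrib diff_divide_distrib)
  have "((\<lambda>h. integral\<^sup>L lborel (?q h)) \<longlongrightarrow> integral\<^sup>L lborel (\<lambda>s. ln s * vg_kernel b k x s)) (at 0 within {-d..d} - {0})"
  proof (rule integral_dominated_convergence_at[where w = ?w])
    show "integrable lborel ?w"
      using vg_kernel_integrable[OF b, of x "k + d"] vg_kernel_integrable[OF b, of x "k + - d"] d
      by (intro Bochner_Integration.integrable_divide Bochner_Integration.integrable_add) auto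
    show "AE s in lborel. ((\<lambda>h. ?q h s) \<longlongrightarrow> ln s * vg_kernel b k x s) (at 0 within {-d..d} - {0})"
    proof (intro AE_I2)
      fix s :: real
      show "((\<lambda>h. ?q h s) \<longlongrightarrow> ln s * vg_kernel b k x s) (at 0 within {-d..d} - {0})"
      proof (cases "0 < s")
        case s: True
        have "((\<lambda>h. s powr h) has_real_derivative ln s) (at 0)"
          using s by (auto intro!: derivative_eq_intros)
        then have "((\<lambda>h. (s powr h - 1) / h) \<longlongrightarrow> ln s) (at 0)"
          using s by (simp add: has_field_derivative_iff)
        then have "((\<lambda>h. (s powr h - 1) / h * vg_kernel b k x s) \<longlongrightarrow> ln s * vg_kernel b k x s) (at 0)"
          by (intro tendsto_intros)
        then have "((\<lambda>h. (s powr h - 1) / h * vg_kernel b k x s) \<longlongrightarrow> ln s * vg_kernel b k x s) (at 0 within {-d..d} - {0})"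
          by (rule tendsto_within_subset) auto
        then show ?thesis
          by (rule tendsto_cong[THEN iffD1, rotated])
            (unfold eventually_at_filter, rule always_eventually, blast intro: qeq[symmetric])
      qed (simp add: vg_kernel_def)
    qed
    fix h assume h: "h \<in> {-d..d} - {0}"
    show "AE s in lborel. norm (?q h s) \<le> ?w s"
    proof (intro AE_I2)
      fix s :: real
      show "norm (?q h s) \<le> ?w s"
      proof (cases "0 < s")
        case s: True
        have "norm (?q h s) = \<bar>(s powr h - 1) / h\<bar> * vg_kernel b k x s"
          using h by (simp add: qeq abs_mult)
        also have "\<dots> \<le> (s powr d + s powr (- d)) / d * vg_kernel b k x s"
          using powr_difference_quotient_bound[OF s, of h d] h by (intro mult_right_mono) auto
        also have "\<dots> = ?w s"
          unfolding vg_kernel_add by (simp add: field_simps)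
        finally show ?thesis .
      qed (simp add: vg_kernel_def)
    qed
  qed measurable
  then have "((\<lambda>h. integral\<^sup>L lborel (?q h)) \<longlongrightarrow> integral\<^sup>L lborel (\<lambda>s. ln s * vg_kernel b k x s)) (at 0 within {-d<..<d} - {0})"
    by (rule tendsto_within_subset) auto
  moreover have "at 0 within {-d<..<d} - {0} = at (0::real)"
    using d at_within_open[of 0 "{-d<..<d}"] by (simp add: at_within_def)
  ultimately have lim: "((\<lambda>h. integral\<^sup>L lborel (?q h)) \<longlongrightarrow> integral\<^sup>L lborel (\<lambda>s. ln s * vg_kernel b k x s)) (at 0)"
    by simp
  have "((\<lambda>h. (bessel_kernel b (k + h) x - bessel_kernel b k x) / h) \<longlongrightarrow> integral\<^sup>L lborel (\<lambda>s. ln s * vg_kernel b k x s)) (at 0)"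
  proof (rule tendsto_cong[THEN iffD1, OF _ lim])
    have "\<forall>\<^sub>F h in at 0. h \<in> {-d<..<d}"
      by (rule eventually_at_in_open') (use d in auto)
    then show "\<forall>\<^sub>F h in at 0. integral\<^sup>L lborel (?q h) = (bessel_kernel b (k + h) x - bessel_kernel b k x) / h"
    proof eventually_elim
      case (elim h)
      then show ?case
        unfolding bessel_kernel_def using d vg_kernel_integrable[OF b, of x k] vg_kernel_integrable[OF b, of x "k + h"]
        by (auto simp: Bochner_Integration.integral_diff)
    qed
  qed
  then show thesis
    by (intro that) (auto simp: DERIV_def)
qed

text \<open>Follows from \<open>s powr k <= 1 + s\<close> on [0,1]. The bound is uniform in
  \<open>k\<close>, and both its terms are recognisable: \<open>k = 0\<close> is the half-stable
  integral and \<open>k = 1\<close> is a multiple of the density at time 1/a.\<close>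

lemma bessel_kernel_le_add:
  assumes b: "0 < b" and x: "x \<noteq> 0" and k: "0 \<le> k" "k \<le> 1"
  shows "bessel_kernel b k x \<le> bessel_kernel b 0 x + bessel_kernel b 1 x"
proof -
  have "bessel_kernel b k x \<le> integral\<^sup>L lborel (\<lambda>s. vg_kernel b 0 x s + vg_kernel b 1 x s)"
    unfolding bessel_kernel_def
  proof (rule integral_mono)
    fix s :: real
    show "vg_kernel b k x s \<le> vg_kernel b 0 x s + vg_kernel b 1 x s"
    proof (cases "0 < s")
      case s: True
      have "s powr k \<le> 1 + s powr 1"
      proof (cases "s \<le> 1")
        case True
        then have "s powr k \<le> 1" using s k powr_le1[of k s] by simp
        then show ?thesis using s by simp
      next
        case False
        then have "s powr k \<le> s powr 1" using k by (intro powr_mono) auto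
        then show ?thesis by simp
      qed
      then have "s powr k * vg_kernel b 0 x s \<le> (1 + s powr 1) * vg_kernel b 0 x s"
        by (intro mult_right_mono) auto
      then show ?thesis
        using vg_kernel_add[of b 0 k x s] vg_kernel_add[of b 0 1 x s] by (simp add: algebra_simps)
    qed (simp add: vg_kernel_def)
  qed (use vg_kernel_integrable b x in auto)
  also have "\<dots> = bessel_kernel b 0 x + bessel_kernel b 1 x"
    unfolding bessel_kernel_def using vg_kernel_integrable b x by (intro Bochner_Integration.integral_add) auto
  finally show ?thesis .
qed

text \<open>True also where the integral diverges: both sides then carry the default value 0 of the
  Bochner integral.\<close>

lemma vg_density_eq:
  "vg_density a b t x = b powr (a * t) / Gamma (a * t) / sqrt (4 * pi) * bessel_kernel b (a * t) x"
proof -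
  have "vg_density a b t x = integral\<^sup>L lborel (\<lambda>s. b powr (a * t) / Gamma (a * t) / sqrt (4 * pi) * vg_kernel b (a * t) x s)"
    unfolding vg_density_def set_lebesgue_integral_def
    by (intro Bochner_Integration.integral_cong refl) (auto simp: vg_kernel_def vg_integrand_eq indicator_def)
  then show ?thesis by (simp add: bessel_kernel_def)
qed

section \<open>Small-time limit and pointwise regularity of the kernel integral\<close>

text \<open>Needed for the antiderivative in \<open>bessel_kernel_0\<close>. Near \<open>x\<close>
  the distribution function is a constant plus an integral over a compact interval starting at x -
  1, to which the fundamental theorem applies.\<close>

lemma cdf_std_normal_deriv:
  "(cdf (density lborel std_normal_density) has_real_derivative std_normal_density x) (at x)"
proof -
  let ?N = "density lborel std_normal_density"
  interpret N: real_distribution ?N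
    by (simp add: real_distribution_def real_distribution_axioms_def prob_space_normal_density)
  have eq: "cdf ?N y = cdf ?N (x - 1) + integral {x - 1..y} std_normal_density" if "x - 1 < y" for y
  proof -
    have c: "continuous_on {x - 1..y} std_normal_density"
      by (auto simp: normal_density_def[abs_def] intro!: continuous_intros)
    have "cdf ?N y - cdf ?N (x - 1) = measure ?N {x - 1<..y}"
      using N.cdf_diff_eq[OF that] by simp
    also have "\<dots> = measure ?N {x - 1..y}"
    proof (rule measure_eq_AE)
      show "AE z in ?N. (z \<in> {x - 1<..y}) = (z \<in> {x - 1..y})"
        using AE_lborel_singleton[of "x - 1"] by (auto simp: AE_density elim!: eventually_mono)
    qed auto
    also have "\<dots> = (LINT z:{x - 1..y}|lborel. std_normal_density z)"
      unfolding measure_def set_lebesgue_integral_def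
      by (subst emeasure_density, simp, simp, subst integral_eq_nn_integral)
        (auto intro!: arg_cong[where f=enn2real] nn_integral_cong simp: indicator_def)
    also have "\<dots> = integral {x - 1..y} std_normal_density"
      using set_borel_integral_eq_integral(2)[OF borel_integrable_atLeastAtMost'[OF c]] .
    finally show ?thesis by simp
  qed
  have "((\<lambda>y. integral {x - 1..y} std_normal_density) has_real_derivative std_normal_density x) (at x within {x - 1..x + 1})"
    by (rule integral_has_real_derivative)
      (auto simp: normal_density_def[abs_def] intro!: continuous_intros)
  then have "((\<lambda>y. cdf ?N (x - 1) + integral {x - 1..y} std_normal_density) has_real_derivative std_normal_density x) (at x)"
    using at_within_interior[of x "{x - 1..x + 1}"] by (auto intro!: derivative_eq_intros)
  then show ?thesis
    by (rule has_field_derivative_transform_within_open[where S = "{x - 1<..}"]) (auto simp: eq)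
qed

lemma bessel_kernel_0:
  assumes b: "0 < b" and x: "x \<noteq> 0"
  shows "bessel_kernel b 0 x = 2 * sqrt pi * exp (- sqrt b * \<bar>x\<bar>) / \<bar>x\<bar>"
proof -
  define r where "r = \<bar>x\<bar>"
  have r: "0 < r" "x\<^sup>2 = r\<^sup>2" using x by (auto simp: r_def)
  let ?N = "density lborel std_normal_density"
  interpret N: real_distribution ?N
    by (simp add: real_distribution_def real_distribution_axioms_def prob_space_normal_density)
  \<comment> \<open>\<open>u\<^sup>2 / 2 = r\<^sup>2 / (4 s) + b s - sqrt b * r\<close> and likewise for \<open>v\<close> with the opposite sign, so the
    integrand has an explicit antiderivative in terms of the normal distribution function.\<close>
  define u where "u s = sqrt 2 * (r / (2 * sqrt s) - sqrt b * sqrt s)" for s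
  define v where "v s = sqrt 2 * (r / (2 * sqrt s) + sqrt b * sqrt s)" for s
  define C where "C = 2 * sqrt pi / r"
  define F where "F s = - (C * (exp (- sqrt b * r) * cdf ?N (u s) + exp (sqrt b * r) * cdf ?N (v s)))" for s
  have std: "std_normal_density z = exp (- z\<^sup>2 / 2) / sqrt (2 * pi)" for z
    by (simp add: std_normal_density_def)
  have dF: "(F has_real_derivative exp (- x\<^sup>2 / (4 * s)) * (s powr (0 - 1/2 - 1) * exp (- b * s))) (at s)" if s: "0 < s" for s
  proof -
    define u' where "u' = sqrt 2 * (- (r / (4 * s * sqrt s)) - sqrt b / (2 * sqrt s))"
    define v' where "v' = sqrt 2 * (- (r / (4 * s * sqrt s)) + sqrt b / (2 * sqrt s))"
    have du: "(u has_real_derivative u') (at s)"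
      unfolding u_def u'_def using s by (auto intro!: derivative_eq_intros simp: field_simps)
    have dv: "(v has_real_derivative v') (at s)"
      unfolding v_def v'_def using s by (auto intro!: derivative_eq_intros simp: field_simps)
    have u2: "(u s)\<^sup>2 / 2 = r\<^sup>2 / (4 * s) + b * s - sqrt b * r"
      unfolding u_def power_mult_distrib power2_diff using s b by (simp add: field_simps power2_eq_square)
    have v2: "(v s)\<^sup>2 / 2 = r\<^sup>2 / (4 * s) + b * s + sqrt b * r"
      unfolding v_def power_mult_distrib power2_sum using s b by (simp add: field_simps power2_eq_square)
    have eu: "exp (- sqrt b * r) * std_normal_density (u s) = exp (- (r\<^sup>2 / (4 * s)) - b * s) / sqrt (2 * pi)"
    proof -
      have "- sqrt b * r + - (u s)\<^sup>2 / 2 = - (r\<^sup>2 / (4 * s)) - b * s" using u2 by linarith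
      then show ?thesis unfolding std times_divide_eq_right exp_add[symmetric] by simp
    qed
    have ev: "exp (sqrt b * r) * std_normal_density (v s) = exp (- (r\<^sup>2 / (4 * s)) - b * s) / sqrt (2 * pi)"
    proof -
      have "sqrt b * r + - (v s)\<^sup>2 / 2 = - (r\<^sup>2 / (4 * s)) - b * s" using v2 by linarith
      then show ?thesis unfolding std times_divide_eq_right exp_add[symmetric] by simp
    qed
    have "(F has_real_derivative - (C * (exp (- sqrt b * r) * (std_normal_density (u s) * u')
        + exp (sqrt b * r) * (std_normal_density (v s) * v')))) (at s)"
      unfolding F_def
      by (intro DERIV_minus DERIV_cmult DERIV_add DERIV_chain2[OF cdf_std_normal_deriv] du dv)
    also have "exp (- sqrt b * r) * (std_normal_density (u s) * u') + exp (sqrt b * r) * (std_normal_density (v s) * v')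
       = exp (- (r\<^sup>2 / (4 * s)) - b * s) / sqrt (2 * pi) * (u' + v')"
      unfolding distrib_left mult.assoc[symmetric] eu ev ..
    \<comment> \<open>In \<open>u' + v'\<close> the terms with \<open>sqrt b\<close> cancel, and
      \<open>C\<close> is chosen so that the rest becomes exactly s^(-3/2).\<close>
    also have "- (C * (exp (- (r\<^sup>2 / (4 * s)) - b * s) / sqrt (2 * pi) * (u' + v')))
       = exp (- (r\<^sup>2 / (4 * s)) - b * s) / (s * sqrt s)"
      unfolding C_def u'_def v'_def using r s by (simp add: field_simps real_sqrt_mult)
    also have "1 / (s * sqrt s) = s powr (0 - 1/2 - 1)"
    proof -
      have "s powr (0 - 1/2 - 1) = s powr (- (1 + 1/2))" by simp
      also have "\<dots> = 1 / (s * sqrt s)"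
        unfolding powr_minus powr_add using s by (simp add: powr_half_sqrt field_simps)
      finally show ?thesis ..
    qed
    then have "exp (- (r\<^sup>2 / (4 * s)) - b * s) / (s * sqrt s)
       = exp (- x\<^sup>2 / (4 * s)) * (s powr (0 - 1/2 - 1) * exp (- b * s))"
      using r by (simp add: exp_diff exp_minus field_simps)
    finally show ?thesis .
  qed
  have top: "(cdf ?N \<longlongrightarrow> 1) at_top" by (rule N.cdf_lim_at_top_prob)
  have bot: "(cdf ?N \<longlongrightarrow> 0) at_bot" by (rule N.cdf_lim_at_bot)
  \<comment> \<open>Only \<open>u\<close> changes the sign of its limit between 0 and infinity.
    Hence the two \<open>v\<close> contributions to the boundary values cancel, and
    \<open>C * exp (- sqrt b * r)\<close> is left.\<close>
  have u0: "filterlim u at_top (at_right 0)" "filterlim v at_top (at_right 0)"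
    unfolding u_def v_def using r b by real_asymp+
  have ui: "filterlim u at_bot at_top" "filterlim v at_top at_top"
    unfolding u_def v_def using r b by real_asymp+
  have F0: "(F \<longlongrightarrow> - (C * (exp (- sqrt b * r) * 1 + exp (sqrt b * r) * 1))) (at_right 0)"
    unfolding F_def by (intro tendsto_intros filterlim_compose[OF top] u0)
  have Fi: "(F \<longlongrightarrow> - (C * (exp (- sqrt b * r) * 0 + exp (sqrt b * r) * 1))) at_top"
    unfolding F_def by (intro tendsto_intros filterlim_compose[OF top] filterlim_compose[OF bot] ui)
  have "(LBINT s=0..\<infinity>. exp (- x\<^sup>2 / (4 * s)) * (s powr (0 - 1/2 - 1) * exp (- b * s))) =
     - (C * (exp (- sqrt b * r) * 0 + exp (sqrt b * r) * 1)) - - (C * (exp (- sqrt b * r) * 1 + exp (sqrt b * r) * 1))"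
  proof (rule interval_integral_FTC_nonneg(2)[where F = F])
    show "DERIV F s :> exp (- x\<^sup>2 / (4 * s)) * (s powr (0 - 1/2 - 1) * exp (- b * s))" if "0 < ereal s" for s
      using dF that by (simp add: zero_ereal_def)
    show "isCont (\<lambda>s. exp (- x\<^sup>2 / (4 * s)) * (s powr (0 - 1/2 - 1) * exp (- b * s))) s" if "0 < ereal s" for s
      using that by (auto intro!: continuous_intros simp: zero_ereal_def)
  qed (use F0 Fi in \<open>auto simp: ereal_tendsto_simps zero_ereal_def\<close>)
  then show ?thesis
    by (simp add: bessel_kernel_def vg_kernel_def[abs_def] interval_lebesgue_integral_0_infty
      set_lebesgue_integral_def C_def r_def distrib_left add_divide_distrib)
qed

section \<open>Hoelder continuity of the kernel integral in the space variable\<close>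

lemma exp_minus_diff_le:
  fixes y z :: real
  shows "\<bar>exp (- y) - exp (- z)\<bar> \<le> \<bar>y - z\<bar> * exp (- min y z)"
proof -
  have *: "exp (- y) - exp (- z) \<le> (z - y) * exp (- y)" for y z :: real
  proof -
    have "(1 - (z - y)) * exp (- y) \<le> exp (- (z - y)) * exp (- y)"
      using exp_ge_add_one_self[of "- (z - y)"] by (simp only: mult_le_cancel_right_pos exp_gt_zero)
    also have "\<dots> = exp (- z)" by (simp add: exp_add[symmetric])
    finally show ?thesis by (simp add: algebra_simps)
  qed
  show ?thesis
    using *[of y z] *[of z y] by (cases "y \<le> z") (auto simp: min_def)
qed

text \<open>Regularity is bought by lowering the exponent. Away from the origin the mean value bound
  on the Gaussian factor costs 1/s, so the exponent drops by 1 and the estimate is Lipschitz. At the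
  origin the exponent must stay above 1/2, so it can drop only by a small \<open>q\<close>, which
  leaves the Hoelder exponent 2 q.\<close>

lemma bessel_kernel_hoelder:
  assumes b: "0 < b" and "x \<noteq> 0 \<or> 1/2 < k"
  obtains C g d where "0 \<le> C" "0 < g" "g \<le> 1" "0 < d"
    "\<And>z. \<bar>z\<bar> \<le> d \<Longrightarrow> \<bar>bessel_kernel b k (x - z) - bessel_kernel b k x\<bar> \<le> C * \<bar>z\<bar> powr g"
proof (cases "x = 0")
  case True
  then have k: "1/2 < k" using assms by simp
  \<comment> \<open>The first entry keeps the Hoelder exponent 2 q at most 1. The second, half the
    distance of \<open>k\<close> from 1/2, keeps k - q above 1/2, so that the lowered kernel is
    still integrable at the origin.\<close>
  define q where "q = min (1/2) ((k - 1/2) / 2)"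
  have q: "0 < q" "q \<le> 1/2" "1/2 < k - q" using k by (auto simp: q_def min_def field_simps)
  have i1: "integrable lborel (vg_kernel b (k + - q) 0)"
    using b q by (intro vg_kernel_integrable) auto
  have "\<bar>bessel_kernel b k (0 - z) - bessel_kernel b k 0\<bar> \<le> bessel_kernel b (k + - q) 0 * \<bar>z\<bar> powr (2 * q)" for z
  proof (cases "z = 0")
    case z: False
    have "\<bar>bessel_kernel b k z - bessel_kernel b k 0\<bar> = \<bar>\<integral>s. vg_kernel b k z s - vg_kernel b k 0 s \<partial>lborel\<bar>"
      unfolding bessel_kernel_def using b k z
      by (subst Bochner_Integration.integral_diff) (auto intro!: vg_kernel_integrable)
    also have "\<dots> \<le> (\<integral>s. \<bar>vg_kernel b k z s - vg_kernel b k 0 s\<bar> \<partial>lborel)"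
      by (rule integral_abs_bound)
    also have "\<dots> \<le> (\<integral>s. \<bar>z\<bar> powr (2 * q) * vg_kernel b (k + - q) 0 s \<partial>lborel)"
    proof (rule integral_mono)
      show "integrable lborel (\<lambda>s. \<bar>vg_kernel b k z s - vg_kernel b k 0 s\<bar>)"
        using b k z by (intro Bochner_Integration.integrable_abs Bochner_Integration.integrable_diff vg_kernel_integrable) auto
      fix s :: real
      show "\<bar>vg_kernel b k z s - vg_kernel b k 0 s\<bar> \<le> \<bar>z\<bar> powr (2 * q) * vg_kernel b (k + - q) 0 s"
      proof (cases "0 < s")
        case s: True
        define w where "w = z\<^sup>2 / (4 * s)"
        have w: "0 < w" using z s by (simp add: w_def)
        \<comment> \<open>Interpolation between the bounds \<open>w\<close> and 1, possible because
          0 < q < 1.\<close>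
        have "1 - exp (- w) \<le> w powr q"
        proof (cases "w \<le> 1")
          case True
          have "1 - exp (- w) \<le> w" using exp_ge_add_one_self[of "- w"] by simp
          also have "w = w powr 1" using w by simp
          also have "\<dots> \<le> w powr q" using w True q by (intro powr_mono') auto
          finally show ?thesis .
        next
          case False
          then have "1 \<le> w powr q" using q by (intro ge_one_powr_ge_zero) auto
          then show ?thesis by (smt (verit) exp_ge_zero)
        qed
        also have "w powr q \<le> \<bar>z\<bar> powr (2 * q) * s powr (- q)"
        proof -
          have "w powr q \<le> (z\<^sup>2 / s) powr q"
            using s w q unfolding w_def by (intro powr_mono2) (auto intro!: divide_left_mono)
          also have "\<dots> = \<bar>z\<bar> powr (2 * q) * s powr (- q)"
            using s by (simp add: powr_divide power2_powr_real powr_minus field_simps)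
          finally show ?thesis .
        qed
        finally have "1 - exp (- w) \<le> \<bar>z\<bar> powr (2 * q) * s powr (- q)" .
        moreover have "\<bar>exp (- w) - 1\<bar> = 1 - exp (- w)" using w by simp
        ultimately have "\<bar>exp (- w) - 1\<bar> * vg_kernel b k 0 s \<le> (\<bar>z\<bar> powr (2 * q) * s powr (- q)) * vg_kernel b k 0 s"
          by (intro mult_right_mono) auto
        moreover have "vg_kernel b k z s - vg_kernel b k 0 s = (exp (- w) - 1) * vg_kernel b k 0 s"
          using s by (simp add: vg_kernel_def w_def left_diff_distrib)
        ultimately show ?thesis
          unfolding vg_kernel_add by (simp only: mult.assoc abs_mult vg_kernel_nonneg abs_of_nonneg)
      qed (simp add: vg_kernel_def)
    qed (use i1 in auto)
    finally have "\<bar>bessel_kernel b k z - bessel_kernel b k 0\<bar> \<le> bessel_kernel b (k + - q) 0 * \<bar>z\<bar> powr (2 * q)"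
      by (simp add: bessel_kernel_def mult.commute)
    then show ?thesis by simp
  qed simp
  then show thesis
    using True q by (intro that[of "bessel_kernel b (k + - q) 0" "2 * q" 1]) auto
next
  case x: False
  \<comment> \<open>For |z| <= m both x and x - z keep distance at least m from the origin, so the
    Gaussian factor at \<open>m\<close> bounds both of theirs.\<close>
  define m where "m = \<bar>x\<bar> / 2"
  have m: "0 < m" using x by (simp add: m_def)
  have i1: "integrable lborel (vg_kernel b (k + - 1) m)"
    using b m by (intro vg_kernel_integrable) auto
  have "\<bar>bessel_kernel b k (x - z) - bessel_kernel b k x\<bar> \<le> \<bar>x\<bar> * bessel_kernel b (k + - 1) m * \<bar>z\<bar> powr 1" if z: "\<bar>z\<bar> \<le> m" for z
  proof -
    have xz: "m \<le> \<bar>x - z\<bar>" "m \<le> \<bar>x\<bar>" "\<bar>x - z\<bar> \<le> 3 * m" using z unfolding m_def by linarith+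
    have ne: "x - z \<noteq> 0" using xz m by auto
    have sq: "m\<^sup>2 \<le> (x - z)\<^sup>2" "m\<^sup>2 \<le> x\<^sup>2"
      using xz m by (auto simp: abs_le_square_iff[symmetric])
    have "\<bar>(x - z)\<^sup>2 - x\<^sup>2\<bar> = \<bar>z\<bar> * \<bar>2 * x - z\<bar>"
      unfolding abs_mult[symmetric] by (simp add: power2_eq_square algebra_simps)
    also have "\<dots> \<le> \<bar>z\<bar> * (4 * \<bar>x\<bar>)" using z m by (intro mult_left_mono) (auto simp: m_def)
    finally have dsq: "\<bar>(x - z)\<^sup>2 - x\<^sup>2\<bar> \<le> \<bar>z\<bar> * (4 * \<bar>x\<bar>)" .
    have "\<bar>bessel_kernel b k (x - z) - bessel_kernel b k x\<bar> = \<bar>\<integral>s. vg_kernel b k (x - z) s - vg_kernel b k x s \<partial>lborel\<bar>"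
      unfolding bessel_kernel_def using b x ne
      by (subst Bochner_Integration.integral_diff) (auto intro!: vg_kernel_integrable)
    also have "\<dots> \<le> (\<integral>s. \<bar>vg_kernel b k (x - z) s - vg_kernel b k x s\<bar> \<partial>lborel)"
      by (rule integral_abs_bound)
    also have "\<dots> \<le> (\<integral>s. \<bar>x\<bar> * \<bar>z\<bar> * vg_kernel b (k + - 1) m s \<partial>lborel)"
    proof (rule integral_mono)
      show "integrable lborel (\<lambda>s. \<bar>vg_kernel b k (x - z) s - vg_kernel b k x s\<bar>)"
        using b x ne by (intro Bochner_Integration.integrable_abs Bochner_Integration.integrable_diff vg_kernel_integrable) auto
      fix s :: real
      show "\<bar>vg_kernel b k (x - z) s - vg_kernel b k x s\<bar> \<le> \<bar>x\<bar> * \<bar>z\<bar> * vg_kernel b (k + - 1) m s"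
      proof (cases "0 < s")
        case s: True
        let ?c = "s powr (k - 1/2 - 1) * exp (- b * s)"
        have "\<bar>exp (- ((x - z)\<^sup>2 / (4 * s))) - exp (- (x\<^sup>2 / (4 * s)))\<bar>
           \<le> \<bar>(x - z)\<^sup>2 / (4 * s) - x\<^sup>2 / (4 * s)\<bar> * exp (- min ((x - z)\<^sup>2 / (4 * s)) (x\<^sup>2 / (4 * s)))"
          by (rule exp_minus_diff_le)
        also have "\<dots> \<le> (\<bar>x\<bar> * \<bar>z\<bar> / s) * exp (- (m\<^sup>2 / (4 * s)))"
        proof (rule mult_mono)
          have "\<bar>(x - z)\<^sup>2 / (4 * s) - x\<^sup>2 / (4 * s)\<bar> = \<bar>(x - z)\<^sup>2 - x\<^sup>2\<bar> / (4 * s)"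
            using s by (simp add: diff_divide_distrib[symmetric])
          also have "\<dots> \<le> (\<bar>z\<bar> * (4 * \<bar>x\<bar>)) / (4 * s)"
            using dsq s by (intro divide_right_mono) auto
          finally show "\<bar>(x - z)\<^sup>2 / (4 * s) - x\<^sup>2 / (4 * s)\<bar> \<le> \<bar>x\<bar> * \<bar>z\<bar> / s"
            by (simp add: mult.commute)
          show "exp (- min ((x - z)\<^sup>2 / (4 * s)) (x\<^sup>2 / (4 * s))) \<le> exp (- (m\<^sup>2 / (4 * s)))"
            using sq s by (auto simp: min_def intro!: divide_right_mono)
        qed (use s in auto)
        finally have "\<bar>exp (- ((x - z)\<^sup>2 / (4 * s))) - exp (- (x\<^sup>2 / (4 * s)))\<bar> * ?c
            \<le> (\<bar>x\<bar> * \<bar>z\<bar> / s) * exp (- (m\<^sup>2 / (4 * s))) * ?c"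
          by (intro mult_right_mono) auto
        also have "\<dots> = \<bar>x\<bar> * \<bar>z\<bar> * (s powr (-1) * vg_kernel b k m s)"
          using s by (simp add: vg_kernel_def powr_minus_divide)
        finally have 1: "\<bar>exp (- ((x - z)\<^sup>2 / (4 * s))) - exp (- (x\<^sup>2 / (4 * s)))\<bar> * ?c \<le> \<bar>x\<bar> * \<bar>z\<bar> * vg_kernel b (k + - 1) m s"
          unfolding vg_kernel_add .
        have "vg_kernel b k (x - z) s - vg_kernel b k x s = (exp (- ((x - z)\<^sup>2 / (4 * s))) - exp (- (x\<^sup>2 / (4 * s)))) * ?c"
          using s by (simp add: vg_kernel_def left_diff_distrib)
        then show ?thesis using 1 by (simp only: abs_mult) simp
      qed (simp add: vg_kernel_def)
    qed (use i1 in auto)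
    finally show ?thesis by (simp add: bessel_kernel_def mult_ac)
  qed
  then show thesis
    using m by (intro that[of "\<bar>x\<bar> * bessel_kernel b (k + - 1) m" 1 m]) auto
qed

section \<open>Differentiating the Weyl integrals\<close>

lemma integrable_exp_minus:
  fixes c :: real assumes "0 < c"
  shows "integrable lborel (\<lambda>s. indicator {0<..} s * exp (- c * s))"
  by (rule Bochner_Integration.integrable_cong[THEN iffD1, OF refl _ integrable_gamma_kernel[OF zero_less_one assms]])
    (auto simp: indicator_def)

lemma levy_density_integrable:
  fixes b z :: real
  assumes "0 < b" "0 < z"
  shows "set_integrable lborel {z<..} (\<lambda>y. exp (- b * y) / y)"
  unfolding set_integrable_def
proof (rule Bochner_Integration.integrable_bound)
  show "integrable lborel (\<lambda>y. 1 / z * (indicator {0<..} y * exp (- b * y)))"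
    using integrable_exp_minus[OF assms(1)] by (rule integrable_mult_right)
  show "AE y in lborel. norm (indicator {z<..} y *\<^sub>R (exp (- b * y) / y)) \<le> norm (1 / z * (indicator {0<..} y * exp (- b * y)))"
    using assms by (intro AE_I2) (auto simp: indicator_def field_simps)
qed measurable

lemma levy_tail_nonneg:
  assumes "0 \<le> a" "0 \<le> z" shows "0 \<le> levy_tail a b z"
  unfolding levy_tail_def set_lebesgue_integral_def using assms
  by (intro mult_nonneg_nonneg integral_nonneg_AE AE_I2) (auto simp: indicator_def)

lemma levy_tail_measurable [measurable]: "levy_tail a b \<in> borel_measurable borel"
proof -
  have "levy_tail a b = (\<lambda>z. a * integral\<^sup>L lborel (\<lambda>y. if z < y then exp (- b * y) / y else 0))"
    unfolding levy_tail_def set_lebesgue_integral_def fun_eq_iff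
    by (auto intro!: arg_cong2[where f="(*)"] Bochner_Integration.integral_cong simp: indicator_def)
  also have "\<dots> \<in> borel_measurable borel" by measurable
  finally show ?thesis .
qed

lemma levy_tail_deriv:
  assumes "0 < b" "0 < z"
  shows "(levy_tail a b has_real_derivative - (a * exp (- b * z) / z)) (at z)"
proof -
  let ?f = "\<lambda>y. exp (- b * y) / y"
  define c where "c = z / 2"
  have c: "0 < c" "c < z" using assms by (auto simp: c_def)
  have cont: "continuous_on {c..y} ?f" for y
    using c by (intro continuous_intros) auto
  have eq: "levy_tail a b y = levy_tail a b c - a * integral {c..y} ?f" if "c < y" for y
  proof -
    have si: "set_integrable lborel {c..y} ?f"
      by (rule borel_integrable_atLeastAtMost'[OF cont])
    have "(LINT w:{c<..}|lborel. ?f w) = (LINT w:{c<..y} \<union> {y<..}|lborel. ?f w)"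
      using that by (simp add: ivl_disj_un)
    also have "\<dots> = (LINT w:{c<..y}|lborel. ?f w) + (LINT w:{y<..}|lborel. ?f w)"
    proof (rule set_integral_Un)
      show "set_integrable lborel {c<..y} ?f" by (rule set_integrable_subset[OF si]) auto
    qed (use c that assms levy_density_integrable[of b y] in auto)
    also have "(LINT w:{c<..y}|lborel. ?f w) = (LINT w:{c..y}|lborel. ?f w)"
      unfolding set_lebesgue_integral_def
      using AE_lborel_singleton[of c] by (intro integral_cong_AE) (auto elim!: eventually_mono simp: indicator_def)
    also have "\<dots> = integral {c..y} ?f"
      using set_borel_integral_eq_integral(2)[OF si] .
    finally show ?thesis by (simp add: levy_tail_def algebra_simps)
  qed
  have "((\<lambda>y. integral {c..y} ?f) has_real_derivative ?f z) (at z within {c..z + 1})"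
    using c by (intro integral_has_real_derivative cont) auto
  then have "((\<lambda>y. integral {c..y} ?f) has_real_derivative ?f z) (at z)"
    using at_within_interior[of z "{c..z + 1}"] c by simp
  then have "((\<lambda>y. levy_tail a b c - a * integral {c..y} ?f) has_real_derivative - (a * ?f z)) (at z)"
    by (auto intro!: derivative_eq_intros)
  then have "(levy_tail a b has_real_derivative - (a * ?f z)) (at z)"
    by (rule has_field_derivative_transform_within_open[where S = "{c<..}"]) (use c in \<open>auto simp: eq\<close>)
  then show ?thesis by simp
qed

text \<open>Mean value theorem: the tail has the Levy density as its negative derivative, and beyond
  \<open>m\<close> that density is largest at \<open>m\<close>.\<close>

lemma levy_tail_diff:
  fixes a b m :: real
  assumes "0 < a" "0 < b" "0 < m" "m \<le> y" "m \<le> z"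
  shows "\<bar>levy_tail a b y - levy_tail a b z\<bar> \<le> \<bar>y - z\<bar> * (a * exp (- b * m) / m)"
proof -
  have *: "\<bar>levy_tail a b y - levy_tail a b z\<bar> \<le> \<bar>y - z\<bar> * (a * exp (- b * m) / m)"
    if yz: "y < z" "m \<le> y" for y z
  proof -
    obtain w where w: "y < w" "w < z" "levy_tail a b z - levy_tail a b y = (z - y) * (- (a * exp (- b * w) / w))"
      using MVT2[OF yz(1), of "levy_tail a b" "\<lambda>w. - (a * exp (- b * w) / w)"] levy_tail_deriv[OF assms(2)] assms yz by (metis less_le_trans)
    have "\<bar>levy_tail a b y - levy_tail a b z\<bar> = (z - y) * (a * exp (- b * w) / w)"
      using w assms yz by (subst abs_minus_commute) (simp add: abs_mult)
    also have "\<dots> \<le> (z - y) * (a * exp (- b * m) / m)"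
      using w assms yz by (intro mult_left_mono frac_le) auto
    finally show ?thesis using yz by simp
  qed
  show ?thesis
    using *[of y z] *[of z y] assms by (cases y z rule: linorder_cases) (auto simp: abs_minus_commute)
qed

text \<open>The integrand splits into the decreasing factor
  \<open>w powr (- e) * exp (- (b / 2) * w)\<close>, which may be evaluated at the lower limit
  \<open>z\<close>, and an integrable gamma integrand. As the tail is only logarithmically singular
  at 0, \<open>e\<close> can be as small as desired.\<close>

lemma levy_tail_bound:
  assumes "0 < a" "0 < b" "0 < e"
  obtains C where "0 \<le> C" "\<And>z. 0 < z \<Longrightarrow> levy_tail a b z \<le> C * (z powr (- e) * exp (- (b / 2) * z))"
proof -
  let ?g = "\<lambda>w. indicator {0<..} w * (w powr (e - 1) * exp (- (b / 2) * w))"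
  have g: "integrable lborel ?g"
    using assms by (intro integrable_gamma_kernel) auto
  show thesis
  proof (rule that[of "a * integral\<^sup>L lborel ?g"])
    show "0 \<le> a * integral\<^sup>L lborel ?g" using assms by simp
    fix z :: real assume z: "0 < z"
    have "(LINT y:{z<..}|lborel. exp (- b * y) / y) \<le> integral\<^sup>L lborel (\<lambda>w. z powr (- e) * exp (- (b / 2) * z) * ?g w)"
      unfolding set_lebesgue_integral_def
    proof (rule integral_mono)
      fix w :: real
      show "indicator {z<..} w *\<^sub>R (exp (- b * w) / w) \<le> z powr (- e) * exp (- (b / 2) * z) * ?g w"
      proof (cases "z < w")
        case True
        have "exp (- b * w) / w = w powr (- e) * exp (- (b / 2) * w) * (w powr (e - 1) * exp (- (b / 2) * w))"
          using True z by (simp add: powr_diff powr_minus exp_add[symmetric] field_simps)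
        also have "\<dots> \<le> z powr (- e) * exp (- (b / 2) * z) * (w powr (e - 1) * exp (- (b / 2) * w))"
          using True z assms by (intro mult_right_mono mult_mono powr_mono2') auto
        finally show ?thesis using True z by simp
      qed (simp add: indicator_def)
    qed (use levy_density_integrable[OF assms(2) z] g in \<open>auto simp: set_integrable_def\<close>)
    then have "levy_tail a b z \<le> a * integral\<^sup>L lborel (\<lambda>w. z powr (- e) * exp (- (b / 2) * z) * ?g w)"
      using assms unfolding levy_tail_def by (intro mult_left_mono) auto
    also have "\<dots> = a * (z powr (- e) * exp (- (b / 2) * z) * integral\<^sup>L lborel ?g)"
      by (simp only: integral_mult_right_zero)
    finally show "levy_tail a b z \<le> a * integral\<^sup>L lborel ?g * (z powr (- e) * exp (- (b / 2) * z))"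
      by (simp add: mult_ac)
  qed
qed

lemma integrable_even_extension:
  fixes f :: "real \<Rightarrow> real"
  assumes "integrable lborel (\<lambda>s. indicator {0<..} s * f s)"
  shows "integrable lborel (\<lambda>s. f \<bar>s\<bar>)"
proof -
  let ?g = "\<lambda>s. indicator {0<..} s * f s"
  have "integrable lborel (\<lambda>s. ?g (0 + (- 1) * s))"
    using assms by (intro lborel_integrable_real_affine) auto
  then have 1: "integrable lborel (\<lambda>s. ?g s + ?g (- s))" using assms by auto
  \<comment> \<open>Neither half line sees \<open>f 0\<close>; it is added back so that
    measurability holds for the function itself and not just almost everywhere.\<close>
  have m: "(\<lambda>s. ?g s + ?g (- s) + indicator {0} s * f 0) \<in> borel_measurable borel"
    using borel_measurable_integrable[OF 1] by (intro borel_measurable_add[of "\<lambda>s. ?g s + ?g (- s)"]) auto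
  have e: "(\<lambda>s. f \<bar>s\<bar>) = (\<lambda>s. ?g s + ?g (- s) + indicator {0} s * f 0)"
    by (auto simp: indicator_def)
  show ?thesis
  proof (rule integrable_cong_AE_imp[OF 1])
    show "(\<lambda>s. f \<bar>s\<bar>) \<in> borel_measurable lborel" using m unfolding e by simp
    show "AE s in lborel. ?g s + ?g (- s) = f \<bar>s\<bar>"
      using AE_lborel_singleton[of 0] by eventually_elim (auto simp: indicator_def)
  qed
qed

text \<open>Up to distance \<open>d\<close> the Hoelder bound leaves the integrable singularity
  |z|^(g-1). Beyond it 1/|z| is at most 1/d, and integrability of \<open>u\<close> together with the
  exponential takes over.\<close>

lemma hoelder_quotient_integrable:
  fixes u :: "real \<Rightarrow> real"
  assumes u: "integrable lborel u" and c: "0 < c"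
    and C: "0 \<le> C" "0 < g" "0 < d" "\<And>z. \<bar>z\<bar> \<le> d \<Longrightarrow> \<bar>u (x - z) - u x\<bar> \<le> C * \<bar>z\<bar> powr g"
  shows "integrable lborel (\<lambda>z. (u (x - z) - u x) * (exp (- c * \<bar>z\<bar>) / \<bar>z\<bar>))"
proof -
  have m[measurable]: "u \<in> borel_measurable borel" using u by auto
  have 1: "integrable lborel (\<lambda>z. \<bar>z\<bar> powr (g - 1) * exp (- c * \<bar>z\<bar>))"
    by (rule integrable_even_extension) (rule integrable_gamma_kernel[OF C(2) c])
  have 2: "integrable lborel (\<lambda>z. exp (- c * \<bar>z\<bar>))"
    by (rule integrable_even_extension) (rule integrable_exp_minus[OF c])
  have "integrable lborel (\<lambda>z. u (x + (- 1) * z))"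
    using u by (intro lborel_integrable_real_affine) auto
  then have 3: "integrable lborel (\<lambda>z. \<bar>u (x - z)\<bar>)" by simp
  show ?thesis
  proof (rule Bochner_Integration.integrable_bound)
    show "integrable lborel (\<lambda>z. C * (\<bar>z\<bar> powr (g - 1) * exp (- c * \<bar>z\<bar>)) + (1 / d * \<bar>u (x - z)\<bar> + \<bar>u x\<bar> / d * exp (- c * \<bar>z\<bar>)))"
      by (intro Bochner_Integration.integrable_add integrable_mult_right 1 2 3)
    show "AE z in lborel. norm ((u (x - z) - u x) * (exp (- c * \<bar>z\<bar>) / \<bar>z\<bar>))
       \<le> norm (C * (\<bar>z\<bar> powr (g - 1) * exp (- c * \<bar>z\<bar>)) + (1 / d * \<bar>u (x - z)\<bar> + \<bar>u x\<bar> / d * exp (- c * \<bar>z\<bar>)))"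
    proof (intro AE_I2)
      fix z :: real
      let ?E = "exp (- c * \<bar>z\<bar>)"
      have E: "0 \<le> ?E" "?E \<le> 1" using c by auto
      let ?A = "C * (\<bar>z\<bar> powr (g - 1) * ?E)" and ?B = "1 / d * \<bar>u (x - z)\<bar> + \<bar>u x\<bar> / d * ?E"
      have AB: "0 \<le> ?A" "0 \<le> ?B" using C by auto
      have "\<bar>u (x - z) - u x\<bar> * (?E / \<bar>z\<bar>) \<le> ?A + ?B"
      proof (cases "z = 0 \<or> d < \<bar>z\<bar>")
        case False
        then have "\<bar>u (x - z) - u x\<bar> * (?E / \<bar>z\<bar>) \<le> C * \<bar>z\<bar> powr g * (?E / \<bar>z\<bar>)"
          using C by (intro mult_right_mono) auto
        also have "\<dots> = ?A" using False by (simp add: powr_diff)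
        finally show ?thesis using AB by simp
      next
        case True
        show ?thesis
        proof (cases "z = 0")
          case False
          with True have z: "d < \<bar>z\<bar>" by simp
          have "\<bar>u (x - z) - u x\<bar> * (?E / \<bar>z\<bar>) \<le> (\<bar>u (x - z)\<bar> + \<bar>u x\<bar>) * (?E / d)"
            using z C by (intro mult_mono divide_left_mono) auto
          also have "\<dots> = \<bar>u (x - z)\<bar> / d * ?E + \<bar>u x\<bar> / d * ?E"
            by (simp add: distrib_right add_divide_distrib)
          also have "\<dots> \<le> \<bar>u (x - z)\<bar> / d * 1 + \<bar>u x\<bar> / d * ?E"
            using E C by (intro add_right_mono mult_left_mono) auto
          finally show ?thesis using AB by simp
        qed (use AB in simp)
      qed
      then show "norm ((u (x - z) - u x) * (?E / \<bar>z\<bar>)) \<le> norm (?A + ?B)"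
        using AB by (simp add: abs_mult)
    qed
  qed measurable
qed

text \<open>Since \<^const>\<open>levy_tail\<close> has a finite integral, subtracting the constant \<open>u x\<close> from \<open>u\<close> does not change the
  difference quotient. The part of the quotient with \<open>\<bar>z\<bar> \<le> 2\<bar>h\<bar>\<close> has no fixed dominating function (the
  singularity of the tail moves with \<open>h\<close>), but it is \<open>O(\<bar>h\<bar> powr (g / 2))\<close>; the rest is dominated. Only
  Hoelder continuity at the single point \<open>x\<close> is used, which is all that the density offers at \<open>0\<close>.\<close>

lemma weyl_integral_plus_deriv:
  fixes u :: "real \<Rightarrow> real"
  assumes a: "0 < a" and b: "0 < b" and u: "integrable lborel u" and dom: "weyl_domain_plus a b u"
    and C: "0 \<le> C" "0 < g" "g \<le> 1" "0 < d" "\<And>z. \<bar>z\<bar> \<le> d \<Longrightarrow> \<bar>u (x - z) - u x\<bar> \<le> C * \<bar>z\<bar> powr g"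
  shows "(weyl_integral_plus a b u has_real_derivative
     (\<integral>z. indicator {0<..} z * ((u x - u (x - z)) * (a * exp (- b * z) / z)) \<partial>lborel)) (at x)"
proof -
  have m[measurable]: "u \<in> borel_measurable borel" using u by auto
  \<comment> \<open>Extending the tail by 0 turns the integral with a moving endpoint into one over
    the whole line, in which passing from x to x + h merely shifts the argument of
    \<open>T\<close>.\<close>
  define T where "T z = (if 0 < z then levy_tail a b z else 0)" for z
  have T0: "0 \<le> T z" for z using levy_tail_nonneg[of a z b] a by (auto simp: T_def)
  have Tm[measurable]: "T \<in> borel_measurable borel" unfolding T_def[abs_def] by measurable
  \<comment> \<open>The tail remains integrable against any power of order \<open>e < 1\<close>:
    half of the margin 1 - e goes to \<open>levy_tail_bound\<close>, and the other half leaves the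
    exponent (1 - e)/2 - 1 above -1.\<close>
  have Tint: "integrable lborel (\<lambda>w. T w * \<bar>w\<bar> powr (- e))" if e: "0 \<le> e" "e < 1" for e
  proof -
    obtain K where K: "0 \<le> K" "\<And>z. 0 < z \<Longrightarrow> levy_tail a b z \<le> K * (z powr (- ((1 - e) / 2)) * exp (- (b / 2) * z))"
      using levy_tail_bound[of a b "(1 - e) / 2"] a b e by auto
    show ?thesis
    proof (rule Bochner_Integration.integrable_bound)
      show "integrable lborel (\<lambda>w. K * (indicator {0<..} w * (w powr ((1 - e) / 2 - 1) * exp (- (b / 2) * w))))"
        using b e by (intro integrable_mult_right integrable_gamma_kernel) auto
      show "AE w in lborel. norm (T w * \<bar>w\<bar> powr (- e)) \<le> norm (K * (indicator {0<..} w * (w powr ((1 - e) / 2 - 1) * exp (- (b / 2) * w))))"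
      proof (intro AE_I2)
        fix w :: real
        show "norm (T w * \<bar>w\<bar> powr (- e)) \<le> norm (K * (indicator {0<..} w * (w powr ((1 - e) / 2 - 1) * exp (- (b / 2) * w))))"
        proof (cases "0 < w")
          case True
          have "levy_tail a b w * w powr (- e) \<le> K * (w powr (- ((1 - e) / 2)) * exp (- (b / 2) * w)) * w powr (- e)"
            using K(2)[OF True] by (intro mult_right_mono) auto
          also have "\<dots> = K * (w powr (- ((1 - e) / 2) + - e) * exp (- (b / 2) * w))"
            unfolding powr_add by simp
          also have "- ((1 - e) / 2) + - e = (1 - e) / 2 - 1" by (simp add: field_simps)
          finally show ?thesis using True T0[of w] K by (simp add: T_def abs_mult)
        qed (simp add: T_def)
      qed
    qed measurable
  qed
  have T1: "integrable lborel T"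
    using Tint[of 0] by (rule_tac integrable_cong_AE_imp) (auto simp: T_def intro!: AE_I2)
  have Th: "integrable lborel (\<lambda>z. T (z + h))" "(\<integral>z. T (z + h) \<partial>lborel) = integral\<^sup>L lborel T" for h
    using lborel_integrable_real_affine[OF T1, of 1 h] lborel_integral_real_affine[of 1 T h] by (simp_all add: add.commute)
  have Isub: "integrable lborel (\<lambda>z. u (x - z) * T (z + h))"
     "weyl_integral_plus a b u (x + h) = (\<integral>z. u (x - z) * T (z + h) \<partial>lborel)" for h
  proof -
    let ?f = "\<lambda>s. u s * T (x + h - s)"
    have f: "?f s = indicator {..<x + h} s *\<^sub>R (u s * levy_tail a b (x + h - s))" for s
      by (auto simp: T_def indicator_def)
    have i: "integrable lborel ?f"
      using dom unfolding f weyl_domain_plus_def set_integrable_def by blast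
    show "integrable lborel (\<lambda>z. u (x - z) * T (z + h))"
      using lborel_integrable_real_affine[OF i, of "-1" x] by (simp add: add.commute)
    have "weyl_integral_plus a b u (x + h) = integral\<^sup>L lborel ?f"
      unfolding weyl_integral_plus_def set_lebesgue_integral_def f ..
    also have "\<dots> = (\<integral>z. u (x - z) * T (z + h) \<partial>lborel)"
      using lborel_integral_real_affine[of "-1" ?f x] by (simp add: add.commute)
    finally show "weyl_integral_plus a b u (x + h) = (\<integral>z. u (x - z) * T (z + h) \<partial>lborel)" .
  qed
  define q where "q h z = (u (x - z) - u x) * ((T (z + h) - T z) / h)" for h z
  have qm[measurable]: "q h \<in> borel_measurable borel" for h
    unfolding q_def[abs_def] by measurable
  have qi: "integrable lborel (q h)"
    and quot: "(weyl_integral_plus a b u (x + h) - weyl_integral_plus a b u x) / h = integral\<^sup>L lborel (q h)"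
    for h
  proof -
    have qe: "q h = (\<lambda>z. ((u (x - z) * T (z + h) - u (x - z) * T (z + 0)) - u x * (T (z + h) - T (z + 0))) / h)"
      by (auto simp: q_def fun_eq_iff field_simps)
    show "integrable lborel (q h)"
      unfolding qe using Isub(1)[of h] Isub(1)[of 0] Th(1)[of h] T1 by auto
    show "(weyl_integral_plus a b u (x + h) - weyl_integral_plus a b u x) / h = integral\<^sup>L lborel (q h)"
      unfolding qe using Isub(1)[of h] Isub(1)[of 0] Th(1)[of h] T1 Isub(2)[of h] Isub(2)[of 0] Th(2)[of h]
      by simp
  qed
  let ?N = "\<lambda>h. {z. \<bar>z\<bar> \<le> 2 * \<bar>h\<bar>}"
  let ?near = "\<lambda>h. \<integral>z. indicator (?N h) z * q h z \<partial>lborel"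
  let ?far = "\<lambda>h. \<integral>z. indicator (- ?N h) z * q h z \<partial>lborel"
  have Nm[measurable]: "?N h \<in> sets borel" for h :: real by measurable
  have ni: "integrable lborel (\<lambda>z. indicator (?N h) z * q h z)"
    and fi: "integrable lborel (\<lambda>z. indicator (- ?N h) z * q h z)" for h
    using integrable_mult_indicator[OF _ qi, of "?N h" h] integrable_mult_indicator[OF _ qi, of "- ?N h" h] by simp_all
  have split: "integral\<^sup>L lborel (q h) = ?near h + ?far h" for h
    unfolding Bochner_Integration.integral_add[OF ni fi, symmetric]
    by (rule Bochner_Integration.integral_cong) (auto simp: indicator_def)

  have far: "(?far \<longlongrightarrow> (\<integral>z. indicator {0<..} z * ((u x - u (x - z)) * (a * exp (- b * z) / z)) \<partial>lborel)) (at 0)"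
  proof (rule integral_dominated_convergence_at[where w = "\<lambda>z. \<bar>2 * a * ((u (x - z) - u x) * (exp (- (b / 2) * \<bar>z\<bar>) / \<bar>z\<bar>))\<bar>"])
    show "integrable lborel (\<lambda>z. \<bar>2 * a * ((u (x - z) - u x) * (exp (- (b / 2) * \<bar>z\<bar>) / \<bar>z\<bar>))\<bar>)"
      using hoelder_quotient_integrable[OF u _ C(1,2,4,5), of "b / 2"] b
      by (intro Bochner_Integration.integrable_abs integrable_mult_right) auto
    show "AE z in lborel. ((\<lambda>h. indicator (- ?N h) z * q h z) \<longlongrightarrow>
        indicator {0<..} z * ((u x - u (x - z)) * (a * exp (- b * z) / z))) (at 0)"
      using AE_lborel_singleton[of 0]
    proof eventually_elim
      case (elim z)
      have small: "\<forall>\<^sub>F h in at 0. \<bar>h\<bar> < \<bar>z\<bar> / 2 \<and> h \<noteq> 0"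
        using eventually_at_in_open[of "{- \<bar>z\<bar> / 2<..<\<bar>z\<bar> / 2}" "0::real"] elim by (auto elim!: eventually_mono)
      show ?case
      proof (cases "0 < z")
        case True
        have "((\<lambda>h. (levy_tail a b (z + h) - levy_tail a b z) / h) \<longlongrightarrow> - (a * exp (- b * z) / z)) (at 0)"
          using levy_tail_deriv[OF b True, of a] by (simp add: DERIV_def)
        then have "((\<lambda>h. (u (x - z) - u x) * ((levy_tail a b (z + h) - levy_tail a b z) / h)) \<longlongrightarrow>
            (u (x - z) - u x) * - (a * exp (- b * z) / z)) (at 0)"
          by (intro tendsto_intros)
        moreover have "\<forall>\<^sub>F h in at 0. (u (x - z) - u x) * ((levy_tail a b (z + h) - levy_tail a b z) / h) = indicator (- ?N h) z * q h z"
          using small by eventually_elim (use True in \<open>auto simp: q_def T_def indicator_def\<close>)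
        ultimately have "((\<lambda>h. indicator (- ?N h) z * q h z) \<longlongrightarrow> (u (x - z) - u x) * - (a * exp (- b * z) / z)) (at 0)"
          by (rule Lim_transform_eventually)
        moreover have "(u (x - z) - u x) * - (a * exp (- b * z) / z)
            = indicator {0<..} z * ((u x - u (x - z)) * (a * exp (- b * z) / z))"
          using True by (simp add: divide_inverse algebra_simps)
        ultimately show ?thesis by simp
      next
        case False
        have "\<forall>\<^sub>F h in at 0. 0 = indicator (- ?N h) z * q h z"
          using small by eventually_elim (use False in \<open>auto simp: q_def T_def indicator_def\<close>)
        then have "((\<lambda>h. indicator (- ?N h) z * q h z) \<longlongrightarrow> 0) (at 0)"
          by (rule Lim_transform_eventually[OF tendsto_const])
        then show ?thesis using False by simp
      qed
    qed
    fix h :: real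
    show "AE z in lborel. norm (indicator (- ?N h) z * q h z) \<le> \<bar>2 * a * ((u (x - z) - u x) * (exp (- (b / 2) * \<bar>z\<bar>) / \<bar>z\<bar>))\<bar>"
    proof (intro AE_I2)
      fix z
      show "norm (indicator (- ?N h) z * q h z) \<le> \<bar>2 * a * ((u (x - z) - u x) * (exp (- (b / 2) * \<bar>z\<bar>) / \<bar>z\<bar>))\<bar>"
      proof (cases "2 * \<bar>h\<bar> < z")
        case True
        then have "0 < z" "0 < z + h" by linarith+
        \<comment> \<open>Since |h| < z/2, both z and z + h are at least z/2. This is what the
          factor 2 in \<open>?N\<close> is for, and it is also the origin of the rate b/2 and the
          factor 2 in the dominating function.\<close>
        have "\<bar>levy_tail a b (z + h) - levy_tail a b z\<bar> \<le> \<bar>z + h - z\<bar> * (a * exp (- b * (z / 2)) / (z / 2))"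
          using True a b \<open>0 < z\<close> by (intro levy_tail_diff) auto
        then have "\<bar>levy_tail a b (z + h) - levy_tail a b z\<bar> / \<bar>h\<bar> \<le> a * exp (- b * (z / 2)) / (z / 2)"
          using a \<open>0 < z\<close> by (cases "h = 0") (auto simp: field_simps)
        then have "\<bar>u (x - z) - u x\<bar> * (\<bar>levy_tail a b (z + h) - levy_tail a b z\<bar> / \<bar>h\<bar>) \<le> \<bar>u (x - z) - u x\<bar> * (a * exp (- b * (z / 2)) / (z / 2))"
          by (intro mult_left_mono) auto
        then show ?thesis
          using True \<open>0 < z\<close> \<open>0 < z + h\<close> a by (simp add: q_def T_def indicator_def abs_mult mult_ac)
      next
        case False
        \<comment> \<open>Either z lies in the near region, or z < -2|h|, or z = 2|h| = 0 does so
          too; outside the near region both values of \<open>T\<close> vanish.\<close>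
        then have "indicator (- ?N h) z * q h z = 0" by (auto simp: q_def T_def indicator_def)
        then show ?thesis by (simp only: norm_zero abs_ge_zero)
      qed
    qed
  qed measurable

  \<comment> \<open>On the near region \<open>u\<close> gains |h|^g, the tail gains |h|^e at the
    price of the weight in \<open>j\<close>, and the quotient loses |h|. The choice makes g + e - 1
    = g/2 positive while e < 1 keeps \<open>j\<close> integrable.\<close>
  define e where "e = 1 - g / 2"
  have e: "0 \<le> e" "e < 1" using C by (auto simp: e_def)
  define j where "j w = T w * \<bar>w\<bar> powr (- e)" for w
  have j0: "0 \<le> j w" for w using T0 by (simp add: j_def)
  have j1: "integrable lborel j" unfolding j_def[abs_def] by (rule Tint[OF e])
  have jh: "integrable lborel (\<lambda>z. j (z + h))" "(\<integral>z. j (z + h) \<partial>lborel) = integral\<^sup>L lborel j" for h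
    using lborel_integrable_real_affine[OF j1, of 1 h] lborel_integral_real_affine[of 1 j h] by (simp_all add: add.commute)
  have Tj: "T w \<le> (3 * \<bar>h\<bar>) powr e * j w" if "\<bar>w\<bar> \<le> 3 * \<bar>h\<bar>" for w h
  proof (cases "0 < w")
    case True
    have "T w = w powr e * j w" using True by (simp add: j_def powr_minus)
    also have "\<dots> \<le> (3 * \<bar>h\<bar>) powr e * j w"
      using that True e j0 by (intro mult_right_mono powr_mono2) auto
    finally show ?thesis .
  qed (use j0 in \<open>simp add: T_def\<close>)
  let ?K = "C * 2 powr g * 3 powr e * (2 * integral\<^sup>L lborel j)"
  have near: "(?near \<longlongrightarrow> 0) (at 0)"
  proof (rule Lim_null_comparison)
    show "((\<lambda>h. ?K * \<bar>h\<bar> powr (g / 2)) \<longlongrightarrow> 0) (at 0)"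
    proof -
      have "((\<lambda>h::real. \<bar>h\<bar> powr (g / 2)) \<longlongrightarrow> 0) (at 0)"
        by (rule tendsto_zero_powrI[where b = "g/2"]) (use C in \<open>auto intro!: tendsto_rabs_zero always_eventually\<close>)
      then show ?thesis by (rule tendsto_mult_right_zero)
    qed
    have "\<forall>\<^sub>F h in at 0. h \<in> {- d / 2<..<d / 2} - {0}"
      by (rule eventually_at_in_open) (use C in auto)
    then show "\<forall>\<^sub>F h in at 0. norm (?near h) \<le> ?K * \<bar>h\<bar> powr (g / 2)"
    proof eventually_elim
      case (elim h)
      then have h: "h \<noteq> 0" "2 * \<bar>h\<bar> \<le> d" by auto
      let ?c = "C * (2 * \<bar>h\<bar>) powr g * (3 * \<bar>h\<bar>) powr e / \<bar>h\<bar>"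
      have "norm (?near h) \<le> (\<integral>z. norm (indicator (?N h) z * q h z) \<partial>lborel)"
        by (rule integral_norm_bound)
      also have "\<dots> \<le> (\<integral>z. ?c * (j (z + h) + j z) \<partial>lborel)"
      proof (rule integral_mono)
        fix z
        show "norm (indicator (?N h) z * q h z) \<le> ?c * (j (z + h) + j z)"
        proof (cases "\<bar>z\<bar> \<le> 2 * \<bar>h\<bar>")
          case True
          have "\<bar>u (x - z) - u x\<bar> \<le> C * \<bar>z\<bar> powr g" using True h by (intro C(5)) auto
          also have "\<dots> \<le> C * (2 * \<bar>h\<bar>) powr g" using True C by (intro mult_left_mono powr_mono2) auto
          finally have 1: "\<bar>u (x - z) - u x\<bar> \<le> C * (2 * \<bar>h\<bar>) powr g" .
          have "\<bar>T (z + h) - T z\<bar> \<le> T (z + h) + T z" using T0[of z] T0[of "z + h"] by linarith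
          also have "\<dots> \<le> (3 * \<bar>h\<bar>) powr e * j (z + h) + (3 * \<bar>h\<bar>) powr e * j z"
            using True by (intro add_mono Tj) auto
          finally have 2: "\<bar>T (z + h) - T z\<bar> \<le> (3 * \<bar>h\<bar>) powr e * (j (z + h) + j z)"
            by (simp add: distrib_left)
          have "norm (indicator (?N h) z * q h z) = \<bar>u (x - z) - u x\<bar> * \<bar>T (z + h) - T z\<bar> / \<bar>h\<bar>"
            using True by (simp add: q_def abs_mult)
          also have "\<dots> \<le> (C * (2 * \<bar>h\<bar>) powr g) * ((3 * \<bar>h\<bar>) powr e * (j (z + h) + j z)) / \<bar>h\<bar>"
            using 1 2 C by (intro divide_right_mono mult_mono) auto
          finally show ?thesis by simp
        qed (use j0 C in \<open>auto intro!: mult_nonneg_nonneg divide_nonneg_nonneg\<close>)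
      qed (use ni[of h] jh(1)[of h] j1 in auto)
      also have "\<dots> = ?c * (2 * integral\<^sup>L lborel j)"
        using jh(1)[of h] j1 jh(2)[of h] by simp
      also have "?c = C * 2 powr g * 3 powr e * \<bar>h\<bar> powr (g / 2)"
      proof -
        have "\<bar>h\<bar> powr g * \<bar>h\<bar> powr e / \<bar>h\<bar> = \<bar>h\<bar> powr (g + e - 1)"
          using h by (simp add: powr_diff powr_add)
        also have "g + e - 1 = g / 2" by (simp add: e_def)
        finally have "C * 2 powr g * 3 powr e * (\<bar>h\<bar> powr g * \<bar>h\<bar> powr e / \<bar>h\<bar>) = C * 2 powr g * 3 powr e * \<bar>h\<bar> powr (g / 2)"
          by simp
        then show ?thesis by (simp add: powr_mult mult_ac)
      qed
      finally show ?case by (simp add: mult_ac)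
    qed
  qed
  have "((\<lambda>h. (weyl_integral_plus a b u (x + h) - weyl_integral_plus a b u x) / h)
     \<longlongrightarrow> 0 + (\<integral>z. indicator {0<..} z * ((u x - u (x - z)) * (a * exp (- b * z) / z)) \<partial>lborel)) (at 0)"
    unfolding quot split by (intro tendsto_add near far)
  then show ?thesis by (simp add: DERIV_def)
qed

section \<open>The convolution semigroup\<close>

lemma heat_kernel_eq_normal_density:
  "0 < s \<Longrightarrow> heat_kernel s x = normal_density 0 (sqrt (2 * s)) x"
  by (simp add: heat_kernel_def normal_density_def)

lemma heat_kernel_measurable [measurable]:
  "(\<lambda>(s, x). heat_kernel s x) \<in> borel_measurable (borel \<Otimes>\<^sub>M borel)"
  unfolding heat_kernel_def by measurable

lemma gamma_subordinator_density_measurable [measurable]: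
  "gamma_subordinator_density a b t \<in> borel_measurable borel"
  unfolding gamma_subordinator_density_def[abs_def] by measurable

lemma gamma_subordinator_density_nonneg:
  "0 < a \<Longrightarrow> 0 < t \<Longrightarrow> 0 \<le> gamma_subordinator_density a b t s"
  by (simp add: gamma_subordinator_density_def Gamma_real_pos less_imp_le)

lemma nn_integral_heat_kernel: "0 < s \<Longrightarrow> (\<integral>\<^sup>+ x. ennreal (heat_kernel s x) \<partial>lborel) = 1"
  by (simp add: heat_kernel_eq_normal_density nn_integral_eq_integral)

lemma heat_kernel_convolution:
  assumes "0 < s" "0 < r"
  shows "(\<integral>\<^sup>+ z. ennreal (heat_kernel s (x - z)) * ennreal (heat_kernel r z) \<partial>lborel) = ennreal (heat_kernel (s + r) x)"
  using fun_cong[OF conv_normal_density_zero_mean[of "sqrt (2 * s)" "sqrt (2 * r)"], of x] assms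
  by (simp add: heat_kernel_eq_normal_density ennreal_mult'[symmetric] distrib_left)

lemma gamma_laplace:
  assumes "0 < z" "0 < c"
  shows "(\<integral>\<^sup>+ s. ennreal (indicator {0<..} s * (s powr (z - 1) * exp (- c * s))) \<partial>lborel) = ennreal (Gamma z / c powr z)"
proof -
  let ?f = "\<lambda>t. ennreal (indicator {0<..} t * (t powr (z - 1) * exp (- t)))"
  have "ennreal (Gamma z) = (\<integral>\<^sup>+ t. ennreal (indicator {0..} t * (t powr (z - 1) / exp t)) \<partial>lborel)"
    using nn_integral_has_integral_lebesgue[OF _ Gamma_integral_real[OF assms(1)]] by simp
  also have "\<dots> = integral\<^sup>N lborel ?f"
    by (intro nn_integral_cong) (auto simp: indicator_def exp_minus field_simps)
  also have "\<dots> = ennreal c * (\<integral>\<^sup>+ s. ?f (0 + c * s) \<partial>lborel)"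
    using assms by (subst nn_integral_real_affine[where c = c and t = 0]) auto
  also have "\<dots> = (\<integral>\<^sup>+ s. ennreal (c powr z) * ennreal (indicator {0<..} s * (s powr (z - 1) * exp (- c * s))) \<partial>lborel)"
  proof (subst nn_integral_cmult[symmetric])
    show "(\<integral>\<^sup>+ s. ennreal c * ?f (0 + c * s) \<partial>lborel) = (\<integral>\<^sup>+ s. ennreal (c powr z) * ennreal (indicator {0<..} s * (s powr (z - 1) * exp (- c * s))) \<partial>lborel)"
    proof (intro nn_integral_cong)
      fix s :: real
      show "ennreal c * ?f (0 + c * s) = ennreal (c powr z) * ennreal (indicator {0<..} s * (s powr (z - 1) * exp (- c * s)))"
        using assms by (auto simp: indicator_def ennreal_mult'[symmetric] powr_mult powr_diff zero_less_mult_iff)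
    qed
  qed measurable
  also have "\<dots> = ennreal (c powr z) * (\<integral>\<^sup>+ s. ennreal (indicator {0<..} s * (s powr (z - 1) * exp (- c * s))) \<partial>lborel)"
    by (rule nn_integral_cmult) measurable
  finally have eq: "ennreal (c powr z) * (\<integral>\<^sup>+ s. ennreal (indicator {0<..} s * (s powr (z - 1) * exp (- c * s))) \<partial>lborel) = ennreal (Gamma z)" ..
  have "ennreal (Gamma z / c powr z) = ennreal (inverse (c powr z)) * ennreal (Gamma z)"
    using assms by (subst ennreal_mult'[symmetric]) (auto simp: field_simps)
  also have "\<dots> = (ennreal (inverse (c powr z)) * ennreal (c powr z)) * (\<integral>\<^sup>+ s. ennreal (indicator {0<..} s * (s powr (z - 1) * exp (- c * s))) \<partial>lborel)"
    unfolding eq[symmetric] by (simp only: mult.assoc)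
  also have "ennreal (inverse (c powr z)) * ennreal (c powr z) = 1"
    using assms by (subst ennreal_mult'[symmetric]) auto
  finally show ?thesis by simp
qed

lemma gamma_subordinator_density_laplace:
  assumes "0 < a" "0 < b" "0 < t" "0 \<le> l"
  shows "(\<integral>\<^sup>+ s. ennreal (exp (- l * s) * gamma_subordinator_density a b t s) \<partial>lborel) = ennreal ((b / (b + l)) powr (a * t))"
proof -
  have at: "0 < a * t" using assms by simp
  let ?c = "b powr (a * t) / Gamma (a * t)"
  have c: "0 \<le> ?c" using Gamma_real_pos[OF at] by simp
  have "(\<integral>\<^sup>+ s. ennreal (exp (- l * s) * gamma_subordinator_density a b t s) \<partial>lborel) =
      (\<integral>\<^sup>+ s. ennreal ?c * ennreal (indicator {0<..} s * (s powr (a * t - 1) * exp (- (b + l) * s))) \<partial>lborel)"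
    using c by (intro nn_integral_cong)
      (auto simp: gamma_subordinator_density_def indicator_def ennreal_mult'[symmetric] distrib_right exp_diff exp_minus exp_add field_simps)
  also have "\<dots> = ennreal ?c * ennreal (Gamma (a * t) / (b + l) powr (a * t))"
    using gamma_laplace[OF at, of "b + l"] assms by (subst nn_integral_cmult) auto
  also have "\<dots> = ennreal ((b / (b + l)) powr (a * t))"
    using c Gamma_real_pos[OF at, THEN less_imp_neq] assms by (subst ennreal_mult'[symmetric]) (auto simp: powr_divide)
  finally show ?thesis .
qed

lemma gamma_subordinator_density_convolution:
  assumes a: "0 < a" and t: "0 < t" and r: "0 < r" and b: "0 < b"
  shows "(\<integral>\<^sup>+ s. ennreal (gamma_subordinator_density a b t s) * ennreal (gamma_subordinator_density a b r (v - s)) \<partial>lborel)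
     = ennreal (gamma_subordinator_density a b (t + r) v)"
proof (cases "0 < v")
  case False
  then show ?thesis
    by (subst nn_integral_0_iff_AE[THEN iffD2]) (auto simp: gamma_subordinator_density_def intro!: AE_I2)
next
  case v: True
  let ?h = "gamma_subordinator_density a b"
  define p where "p = a * t"
  define q where "q = a * r"
  have pq: "0 < p" "0 < q" "a * (t + r) = p + q" using a t r by (auto simp: p_def q_def algebra_simps)
  let ?B = "\<lambda>u. u powr (p - 1) * (1 - u) powr (q - 1)"
  \<comment> \<open>Everything independent of \<open>u\<close> after the substitution s = v u. The
    division by \<open>v\<close> comes from multiplying the two powers of \<open>v\<close> and
    cancels against the Jacobian.\<close>
  let ?c = "b powr p / Gamma p * (b powr q / Gamma q) * exp (- b * v) * v powr (p + q - 1) / v"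
  have G: "0 < Gamma p" "0 < Gamma q" "0 < Gamma (p + q)" using pq by (auto intro!: Gamma_real_pos)
  have c: "0 \<le> ?c" using G v by simp
  have "(\<integral>\<^sup>+ s. ennreal (?h t s) * ennreal (?h r (v - s)) \<partial>lborel)
      = ennreal v * (\<integral>\<^sup>+ u. ennreal (?h t (0 + v * u)) * ennreal (?h r (v - (0 + v * u))) \<partial>lborel)"
    using v by (subst nn_integral_real_affine[where c = v and t = 0]) auto
  also have "(\<integral>\<^sup>+ u. ennreal (?h t (0 + v * u)) * ennreal (?h r (v - (0 + v * u))) \<partial>lborel)
      = (\<integral>\<^sup>+ u. ennreal ?c * ennreal (indicator {0..1} u * ?B u) \<partial>lborel)"
  proof (intro nn_integral_cong)
    fix u :: real
    have e: "v - (0 + v * u) = v * (1 - u)" by (simp add: algebra_simps)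
    show "ennreal (?h t (0 + v * u)) * ennreal (?h r (v - (0 + v * u))) = ennreal ?c * ennreal (indicator {0..1} u * ?B u)"
    proof (cases "0 < u \<and> u < 1")
      case True
      have e1: "exp (- b * (v * u)) * exp (- b * (v * (1 - u))) = exp (- b * v)"
        by (simp add: exp_add[symmetric] algebra_simps)
      have e2: "v powr (p - 1) * v powr (q - 1) = v powr (p + q - 1) / v"
        using v by (simp add: powr_add[symmetric] powr_diff field_simps)
      have 1: "?h t (v * u) = b powr p / Gamma p * (v powr (p - 1) * u powr (p - 1)) * exp (- b * (v * u))"
        using True v by (simp add: gamma_subordinator_density_def p_def powr_mult)
      have 2: "?h r (v * (1 - u)) = b powr q / Gamma q * (v powr (q - 1) * (1 - u) powr (q - 1)) * exp (- b * (v * (1 - u)))"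
        using True v by (simp add: gamma_subordinator_density_def q_def powr_mult)
      have "?h t (v * u) * ?h r (v * (1 - u)) = b powr p / Gamma p * (b powr q / Gamma q) *
          (exp (- b * (v * u)) * exp (- b * (v * (1 - u)))) * (v powr (p - 1) * v powr (q - 1)) * ?B u"
        unfolding 1 2 by (simp only: mult_ac)
      also have "\<dots> = ?c * ?B u" unfolding e1 e2 by simp
      finally have "?h t (v * u) * ?h r (v * (1 - u)) = ?c * ?B u" .
      then show ?thesis
        unfolding e using True c G by (simp add: ennreal_mult'[symmetric] gamma_subordinator_density_nonneg a r t)
    next
      case False
      then consider "u \<le> 0" | "1 \<le> u" by linarith
      then show ?thesis
        unfolding e using v by cases (auto simp: gamma_subordinator_density_def zero_less_mult_iff indicator_def)
    qed
  qed
  also have "\<dots> = ennreal ?c * ennreal (Beta p q)"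
    using nn_integral_has_integral_lebesgue[OF _ has_integral_Beta_real[OF pq(1,2)]]
    by (subst nn_integral_cmult) auto
  also have "ennreal v * (ennreal ?c * ennreal (Beta p q)) = ennreal (v * (?c * Beta p q))"
    unfolding ennreal_mult'[OF c, symmetric] ennreal_mult'[OF less_imp_le[OF v], symmetric] ..
  also have "v * (?c * Beta p q) = ?h (t + r) v"
    using v G pq(3) by (simp add: gamma_subordinator_density_def Beta_def powr_add field_simps)
  finally show ?thesis .
qed

text \<open>An \<open>ennreal\<close>-valued version of the density: the convolution identity for it holds at every point,
  including \<open>x = 0\<close> where it may be infinite and \<^const>\<open>vg_density\<close> has its junk value.\<close>

definition vg_nn_density :: "real \<Rightarrow> real \<Rightarrow> real \<Rightarrow> real \<Rightarrow> ennreal" where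
  "vg_nn_density a b t x = (\<integral>\<^sup>+ s. ennreal (heat_kernel s x) * ennreal (gamma_subordinator_density a b t s) \<partial>lborel)"

lemma vg_nn_density_measurable [measurable]: "vg_nn_density a b t \<in> borel_measurable borel"
  unfolding vg_nn_density_def[abs_def] by measurable

lemma vg_density_nonneg:
  assumes "0 < a" "0 < t" shows "0 \<le> vg_density a b t x"
  using assms unfolding vg_density_eq by (auto intro!: mult_nonneg_nonneg divide_nonneg_nonneg simp: Gamma_real_pos less_imp_le)

lemma vg_density_measurable [measurable]: "vg_density a b t \<in> borel_measurable borel"
  unfolding vg_density_eq[abs_def] by measurable

lemma vg_nn_density_eq:
  assumes a: "0 < a" and b: "0 < b" and t: "0 < t" and x: "x \<noteq> 0 \<or> 1/2 < a * t"
  shows "vg_nn_density a b t x = ennreal (vg_density a b t x)"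
proof -
  have G: "0 < Gamma (a * t)" using a t by (intro Gamma_real_pos) simp
  let ?c = "b powr (a * t) / Gamma (a * t) / sqrt (4 * pi)"
  have "vg_nn_density a b t x = (\<integral>\<^sup>+ s. ennreal (?c * vg_kernel b (a * t) x s) \<partial>lborel)"
    unfolding vg_nn_density_def
  proof (intro nn_integral_cong)
    fix s :: real
    show "ennreal (heat_kernel s x) * ennreal (gamma_subordinator_density a b t s) = ennreal (?c * vg_kernel b (a * t) x s)"
    proof (cases "0 < s")
      case True
      then show ?thesis
        using vg_integrand_eq[OF True, of x a b t]
        by (simp add: vg_kernel_def ennreal_mult'[symmetric] heat_kernel_def)
    qed (simp add: vg_kernel_def gamma_subordinator_density_def)
  qed
  also have "\<dots> = ennreal (\<integral>s. ?c * vg_kernel b (a * t) x s \<partial>lborel)"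
    using G vg_kernel_integrable[OF b x] by (intro nn_integral_eq_integral) auto
  finally show ?thesis by (simp add: vg_density_eq bessel_kernel_def)
qed

lemma vg_nn_density_AE:
  assumes "0 < a" "0 < b" "0 < t"
  shows "AE x in lborel. vg_nn_density a b t x = ennreal (vg_density a b t x)"
  using AE_lborel_singleton[of 0] by eventually_elim (use vg_nn_density_eq[OF assms] in auto)

lemma nn_integral_vg_nn_density:
  assumes "0 < a" "0 < b" "0 < t"
  shows "(\<integral>\<^sup>+ x. vg_nn_density a b t x \<partial>lborel) = 1"
proof -
  have "(\<integral>\<^sup>+ x. vg_nn_density a b t x \<partial>lborel)
      = (\<integral>\<^sup>+ s. (\<integral>\<^sup>+ x. ennreal (heat_kernel s x) * ennreal (gamma_subordinator_density a b t s) \<partial>lborel) \<partial>lborel)"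
    unfolding vg_nn_density_def by (rule lborel_pair.Fubini') measurable
  also have "\<dots> = (\<integral>\<^sup>+ s. ennreal (exp (- 0 * s) * gamma_subordinator_density a b t s) \<partial>lborel)"
  proof (intro nn_integral_cong)
    fix s :: real
    show "(\<integral>\<^sup>+ x. ennreal (heat_kernel s x) * ennreal (gamma_subordinator_density a b t s) \<partial>lborel)
        = ennreal (exp (- 0 * s) * gamma_subordinator_density a b t s)"
    proof (cases "0 < s")
      case True
      then show ?thesis by (subst nn_integral_multc) (auto simp: nn_integral_heat_kernel)
    qed (simp add: gamma_subordinator_density_def)
  qed
  also have "\<dots> = 1"
    using gamma_subordinator_density_laplace[OF assms, of 0] assms by simp
  finally show ?thesis .
qed

lemma vg_density_integrable:
  assumes "0 < a" "0 < b" "0 < t"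
  shows "integrable lborel (vg_density a b t)" "integral\<^sup>L lborel (vg_density a b t) = 1"
proof -
  have 1: "(\<integral>\<^sup>+ x. ennreal (vg_density a b t x) \<partial>lborel) = ennreal 1"
    using nn_integral_vg_nn_density[OF assms] nn_integral_cong_AE[OF vg_nn_density_AE[OF assms]] by simp
  have "has_bochner_integral lborel (vg_density a b t) 1"
    using vg_density_nonneg[OF assms(1,3)] by (intro has_bochner_integral_nn_integral[OF _ _ _ 1]) auto
  then show "integrable lborel (vg_density a b t)" "integral\<^sup>L lborel (vg_density a b t) = 1"
    by (simp_all add: has_bochner_integral_iff)
qed

text \<open>All integrands are nonnegative, so Tonelli allows any order. The space integral is done
  first and merges two heat kernels into one at time s + w; the substitution v = s + w then leaves
  the convolution of the gamma densities.\<close>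

lemma vg_nn_density_convolution:
  assumes a: "0 < a" and b: "0 < b" and t: "0 < t" and r: "0 < r"
  shows "(\<integral>\<^sup>+ z. vg_nn_density a b t (x - z) * vg_nn_density a b r z \<partial>lborel) = vg_nn_density a b (t + r) x"
proof -
  let ?h = "\<lambda>t s. ennreal (gamma_subordinator_density a b t s)"
  let ?g = "\<lambda>s x. ennreal (heat_kernel s x)"
  have "(\<integral>\<^sup>+ z. vg_nn_density a b t (x - z) * vg_nn_density a b r z \<partial>lborel)
      = (\<integral>\<^sup>+ z. (\<integral>\<^sup>+ s. \<integral>\<^sup>+ w. (?g s (x - z) * ?h t s) * (?g w z * ?h r w) \<partial>lborel \<partial>lborel) \<partial>lborel)"
    unfolding vg_nn_density_def by (simp add: nn_integral_cmult nn_integral_multc)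
  also have "\<dots> = (\<integral>\<^sup>+ s. \<integral>\<^sup>+ z. (\<integral>\<^sup>+ w. (?g s (x - z) * ?h t s) * (?g w z * ?h r w) \<partial>lborel) \<partial>lborel \<partial>lborel)"
    by (rule lborel_pair.Fubini') measurable
  also have "\<dots> = (\<integral>\<^sup>+ s. \<integral>\<^sup>+ w. (\<integral>\<^sup>+ z. (?g s (x - z) * ?h t s) * (?g w z * ?h r w) \<partial>lborel) \<partial>lborel \<partial>lborel)"
    by (intro nn_integral_cong lborel_pair.Fubini') measurable
  also have "\<dots> = (\<integral>\<^sup>+ s. \<integral>\<^sup>+ w. ?g (s + w) x * (?h t s * ?h r w) \<partial>lborel \<partial>lborel)"
  proof (intro nn_integral_cong)
    fix s w :: real
    have "(\<integral>\<^sup>+ z. (?g s (x - z) * ?h t s) * (?g w z * ?h r w) \<partial>lborel)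
        = (\<integral>\<^sup>+ z. (?g s (x - z) * ?g w z) * (?h t s * ?h r w) \<partial>lborel)"
      by (simp only: mult_ac)
    also have "\<dots> = (\<integral>\<^sup>+ z. ?g s (x - z) * ?g w z \<partial>lborel) * (?h t s * ?h r w)"
      by (rule nn_integral_multc) measurable
    \<comment> \<open>For s <= 0 or w <= 0 the heat kernels mean nothing, but one of the gamma
      densities is 0.\<close>
    also have "\<dots> = ?g (s + w) x * (?h t s * ?h r w)"
      by (cases "0 < s \<and> 0 < w") (auto simp: heat_kernel_convolution gamma_subordinator_density_def)
    finally show "(\<integral>\<^sup>+ z. (?g s (x - z) * ?h t s) * (?g w z * ?h r w) \<partial>lborel) = ?g (s + w) x * (?h t s * ?h r w)" .
  qed
  also have "\<dots> = (\<integral>\<^sup>+ s. \<integral>\<^sup>+ v. ?g v x * (?h t s * ?h r (v - s)) \<partial>lborel \<partial>lborel)"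
  proof (rule nn_integral_cong)
    fix s :: real
    show "(\<integral>\<^sup>+ w. ?g (s + w) x * (?h t s * ?h r w) \<partial>lborel) = (\<integral>\<^sup>+ v. ?g v x * (?h t s * ?h r (v - s)) \<partial>lborel)"
      by (subst (2) nn_integral_real_affine[where c = 1 and t = s]) auto
  qed
  also have "\<dots> = (\<integral>\<^sup>+ v. \<integral>\<^sup>+ s. ?g v x * (?h t s * ?h r (v - s)) \<partial>lborel \<partial>lborel)"
    by (rule lborel_pair.Fubini') measurable
  also have "\<dots> = vg_nn_density a b (t + r) x"
    unfolding vg_nn_density_def
    by (simp add: nn_integral_cmult gamma_subordinator_density_convolution[OF a t r b])
  finally show ?thesis .
qed

section \<open>The evolution equation\<close>

text \<open>\<open>u\<close> may be singular at s = 0 with order r and the tail at s = x with a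
  small order e, and the two points coincide when x = 0. Bounding the product by the sum of two
  singularities of order r + e covers all cases, and both are integrable because r + e < 1.\<close>

lemma weyl_domain_plus_of_powr_bound:
  fixes u :: "real \<Rightarrow> real"
  assumes a: "0 < a" and b: "0 < b" and u[measurable]: "u \<in> borel_measurable borel"
    and C: "0 \<le> C" "0 \<le> r" "r < 1" "\<And>s. s \<noteq> 0 \<Longrightarrow> \<bar>u s\<bar> \<le> C * \<bar>s\<bar> powr (- r)"
  shows "weyl_domain_plus a b u"
  unfolding weyl_domain_plus_def set_integrable_def
proof
  fix x
  define e where "e = (1 - r) / 2"
  define k where "k = r + e"
  have e: "0 < e" "k < 1" "0 < k" using C by (auto simp: e_def k_def field_simps)
  obtain K where K: "0 \<le> K" "\<And>z. 0 < z \<Longrightarrow> levy_tail a b z \<le> K * (z powr (- e) * exp (- (b / 2) * z))"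
    using levy_tail_bound[OF a b e(1)] by auto
  let ?g = "\<lambda>s. \<bar>s\<bar> powr (- k) * exp (- (b / 2) * \<bar>s\<bar>)"
  have g: "integrable lborel ?g"
  proof (rule integrable_even_extension)
    show "integrable lborel (\<lambda>s. indicator {0<..} s * (s powr (- k) * exp (- (b / 2) * s)))"
      using integrable_gamma_kernel[of "1 - k" "b / 2"] e b by simp
  qed
  have gx: "integrable lborel (\<lambda>s. ?g (x - s))"
    using lborel_integrable_real_affine[OF g, of "-1" x] by simp
  let ?w = "\<lambda>s. C * K * (exp (b / 2 * \<bar>x\<bar>) * ?g s + ?g (x - s))"
  show "integrable lborel (\<lambda>s. indicator {..<x} s *\<^sub>R (u s * levy_tail a b (x - s)))"
  proof (rule Bochner_Integration.integrable_bound)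
    show "integrable lborel ?w"
      by (intro integrable_mult_right Bochner_Integration.integrable_add g gx)
    show "AE s in lborel. norm (indicator {..<x} s *\<^sub>R (u s * levy_tail a b (x - s))) \<le> norm (?w s)"
      using AE_lborel_singleton[of 0]
    proof eventually_elim
      case (elim s)
      show ?case
      proof (cases "s < x")
        case True
        \<comment> \<open>Both negative powers decrease in the distance to their singular point, so
          both may be evaluated at the smaller of the two distances, where their orders add up to
          \<open>k\<close>.\<close>
        define m where "m = min \<bar>s\<bar> (x - s)"
        have m: "0 < m" "m \<le> \<bar>s\<bar>" "m \<le> x - s" using True elim by (auto simp: m_def)
        let ?E = "exp (- (b / 2) * (x - s))"
        have "\<bar>u s\<bar> * levy_tail a b (x - s) \<le> (C * \<bar>s\<bar> powr (- r)) * (K * ((x - s) powr (- e) * ?E))"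
          using C(4)[OF elim] K(2)[of "x - s"] True C by (intro mult_mono levy_tail_nonneg) (use a in auto)
        also have "\<dots> = C * K * ((\<bar>s\<bar> powr (- r) * (x - s) powr (- e)) * ?E)" by simp
        also have "\<dots> \<le> C * K * ((\<bar>s\<bar> powr (- k) + (x - s) powr (- k)) * ?E)"
        proof (intro mult_left_mono mult_right_mono)
          have "\<bar>s\<bar> powr (- r) * (x - s) powr (- e) \<le> m powr (- r) * m powr (- e)"
            using m C e by (intro mult_mono powr_mono2') auto
          also have "\<dots> = m powr (- k)" by (simp add: powr_add[symmetric] k_def)
          also have "\<dots> \<le> \<bar>s\<bar> powr (- k) + (x - s) powr (- k)" by (auto simp: m_def min_def)
          finally show "\<bar>s\<bar> powr (- r) * (x - s) powr (- e) \<le> \<bar>s\<bar> powr (- k) + (x - s) powr (- k)" .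
        qed (use C K in auto)
        also have "\<dots> \<le> ?w s"
        proof -
          \<comment> \<open>The exponential decays in the distance x - s; the triangle inequality
            converts this into decay in |s| at the price of a constant depending on
            \<open>x\<close>.\<close>
          have "b / 2 * \<bar>s\<bar> \<le> b / 2 * (\<bar>x\<bar> + (x - s))" using True b by (intro mult_left_mono) auto
          then have "- (b / 2) * (x - s) \<le> b / 2 * \<bar>x\<bar> + - (b / 2) * \<bar>s\<bar>"
            by (simp only: distrib_left mult_minus_left)
          then have "?E \<le> exp (b / 2 * \<bar>x\<bar>) * exp (- (b / 2) * \<bar>s\<bar>)" unfolding exp_add[symmetric] by simp
          then have "\<bar>s\<bar> powr (- k) * ?E \<le> \<bar>s\<bar> powr (- k) * (exp (b / 2 * \<bar>x\<bar>) * exp (- (b / 2) * \<bar>s\<bar>))"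
            by (intro mult_left_mono) auto
          then have "(\<bar>s\<bar> powr (- k) + (x - s) powr (- k)) * ?E \<le> exp (b / 2 * \<bar>x\<bar>) * ?g s + ?g (x - s)"
            using True unfolding mult.left_commute[of "exp (b / 2 * \<bar>x\<bar>)"] distrib_right by simp
          then show ?thesis using C K by (intro mult_left_mono) auto
        qed
        finally have "\<bar>u s\<bar> * levy_tail a b (x - s) \<le> ?w s" .
        then show ?thesis
          using True levy_tail_nonneg[of a "x - s" b] a C K by (simp add: abs_mult)
      qed simp
    qed
  qed measurable
qed

text \<open>Reflection \<open>s\<close> to \<open>- s\<close>. The density is even in space, so all
  results on the minus operator follow from those on the plus operator.\<close>

lemma weyl_minus_even:
  fixes u :: "real \<Rightarrow> real"
  assumes even: "\<And>s. u (- s) = u s"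
  shows "weyl_domain_minus a b u \<longleftrightarrow> weyl_domain_plus a b u"
    and "weyl_integral_minus a b u x = weyl_integral_plus a b u (- x)"
proof -
  let ?f = "\<lambda>x s. indicator {..<x} s *\<^sub>R (u s * levy_tail a b (x - s))"
  let ?g = "\<lambda>x s. indicator {x<..} s *\<^sub>R (u s * levy_tail a b (s - x))"
  have fg: "?g x s = ?f (- x) (0 + (- 1) * s)" "?f x s = ?g (- x) (0 + (- 1) * s)" for x s
    by (auto simp: indicator_def even add.commute)
  have 1: "integrable lborel (?g x)" if "integrable lborel (?f (- x))" for x
    unfolding fg(1) by (rule lborel_integrable_real_affine[OF that]) simp
  have 2: "integrable lborel (?f x)" if "integrable lborel (?g (- x))" for x
    unfolding fg(2) by (rule lborel_integrable_real_affine[OF that]) simp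
  show "weyl_domain_minus a b u \<longleftrightarrow> weyl_domain_plus a b u"
    unfolding weyl_domain_minus_def weyl_domain_plus_def set_integrable_def using 1 2 by blast
  show "weyl_integral_minus a b u x = weyl_integral_plus a b u (- x)"
    unfolding weyl_integral_minus_def weyl_integral_plus_def set_lebesgue_integral_def fg(1)
    using lborel_integral_real_affine[of "-1" "?f (- x)" 0] by simp
qed

lemma vg_density_minus [simp]: "vg_density a b t (- x) = vg_density a b t x"
  by (simp add: vg_density_eq)

lemma vg_density_weyl_domain:
  assumes a: "0 < a" and b: "0 < b" and t: "0 < t"
  shows "weyl_domain_plus a (sqrt b) (vg_density a b t)"
proof -
  \<comment> \<open>The singularity bound needs a t + q > 1/2, and local integrability needs q <
    1/2. The second entry is the midpoint of 1/2 - a t and 1/2; the first keeps \<open>q\<close>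
    positive for large a t.\<close>
  define q where "q = max (1/4) ((1/2 - a * t) / 2 + 1/4)"
  have "0 < a * t" using a t by simp
  then have q: "0 < q" "q < 1/2" "1/2 < a * t + q" by (auto simp: q_def max_def field_simps)
  obtain C where C: "0 \<le> C" "\<And>x. x \<noteq> 0 \<Longrightarrow> bessel_kernel b (a * t) x \<le> C * \<bar>x\<bar> powr (- (2 * q))"
    using bessel_kernel_powr_bound[OF b q(1,3)] by auto
  let ?c = "b powr (a * t) / Gamma (a * t) / sqrt (4 * pi)"
  have c: "0 \<le> ?c" using Gamma_real_pos[OF \<open>0 < a * t\<close>] by simp
  show ?thesis
  proof (rule weyl_domain_plus_of_powr_bound[where C = "?c * C" and r = "2 * q"])
    fix s :: real assume "s \<noteq> 0"
    then have "?c * bessel_kernel b (a * t) s \<le> ?c * (C * \<bar>s\<bar> powr (- (2 * q)))"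
      using C c by (intro mult_left_mono) auto
    then show "\<bar>vg_density a b t s\<bar> \<le> ?c * C * \<bar>s\<bar> powr (- (2 * q))"
      using vg_density_nonneg[OF a t, of b s] by (simp only: vg_density_eq mult.assoc abs_of_nonneg)
  qed (use a b C q c in auto)
qed

lemma vg_density_hoelder:
  assumes a: "0 < a" and b: "0 < b" and t: "0 < t" and x: "x \<noteq> 0 \<or> 1/2 < a * t"
  obtains C g d where "0 \<le> C" "0 < g" "g \<le> 1" "0 < d"
    "\<And>z. \<bar>z\<bar> \<le> d \<Longrightarrow> \<bar>vg_density a b t (x - z) - vg_density a b t x\<bar> \<le> C * \<bar>z\<bar> powr g"
proof -
  obtain C g d where C: "0 \<le> C" "0 < g" "g \<le> 1" "0 < d"
    "\<And>z. \<bar>z\<bar> \<le> d \<Longrightarrow> \<bar>bessel_kernel b (a * t) (x - z) - bessel_kernel b (a * t) x\<bar> \<le> C * \<bar>z\<bar> powr g"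
    by (rule bessel_kernel_hoelder[OF b x], rule that)
  let ?c = "b powr (a * t) / Gamma (a * t) / sqrt (4 * pi)"
  have c: "0 \<le> ?c" using Gamma_real_pos[of "a * t"] a t by simp
  show thesis
  proof (rule that[of "?c * C" g d])
    fix z :: real assume "\<bar>z\<bar> \<le> d"
    then have "?c * \<bar>bessel_kernel b (a * t) (x - z) - bessel_kernel b (a * t) x\<bar> \<le> ?c * (C * \<bar>z\<bar> powr g)"
      using C(5) c by (intro mult_left_mono) auto
    moreover have "\<bar>vg_density a b t (x - z) - vg_density a b t x\<bar> = ?c * \<bar>bessel_kernel b (a * t) (x - z) - bessel_kernel b (a * t) x\<bar>"
      unfolding vg_density_eq right_diff_distrib[symmetric] abs_mult abs_of_nonneg[OF c] ..
    ultimately show "\<bar>vg_density a b t (x - z) - vg_density a b t x\<bar> \<le> ?c * C * \<bar>z\<bar> powr g"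
      by simp
  next
    show "0 \<le> ?c * C" by (rule mult_nonneg_nonneg[OF c C(1)])
  qed (use C in auto)
qed

text \<open>The factors may be infinite at z = x and z = 0, but these points form a null set, so
  finiteness matters only at (t + r, x), where the real value is read off.\<close>

lemma vg_density_convolution:
  assumes a: "0 < a" and b: "0 < b" and t: "0 < t" and r: "0 < r" and x: "x \<noteq> 0 \<or> 1/2 < a * (t + r)"
  shows "has_bochner_integral lborel (\<lambda>z. vg_density a b t (x - z) * vg_density a b r z) (vg_density a b (t + r) x)"
proof (rule has_bochner_integral_nn_integral)
  have "(\<integral>\<^sup>+ z. ennreal (vg_density a b t (x - z) * vg_density a b r z) \<partial>lborel)
      = (\<integral>\<^sup>+ z. vg_nn_density a b t (x - z) * vg_nn_density a b r z \<partial>lborel)"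
  proof (rule nn_integral_cong_AE)
    show "AE z in lborel. ennreal (vg_density a b t (x - z) * vg_density a b r z) = vg_nn_density a b t (x - z) * vg_nn_density a b r z"
      using AE_lborel_singleton[of 0] AE_lborel_singleton[of x]
      by eventually_elim (auto simp: vg_nn_density_eq[OF a b t] vg_nn_density_eq[OF a b r] ennreal_mult' vg_density_nonneg[OF a t])
  qed
  also have "\<dots> = ennreal (vg_density a b (t + r) x)"
    unfolding vg_nn_density_convolution[OF a b t r] using t r x by (intro vg_nn_density_eq a b) auto
  finally show "(\<integral>\<^sup>+ z. ennreal (vg_density a b t (x - z) * vg_density a b r z) \<partial>lborel) = ennreal (vg_density a b (t + r) x)" .
qed (use vg_density_nonneg[OF a] t r in auto)

lemma vg_density_differentiable_time:
  assumes a: "0 < a" and b: "0 < b" and t: "0 < t" and x: "x \<noteq> 0 \<or> 1/2 < a * t"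
  obtains D where "((\<lambda>r. vg_density a b r x) has_real_derivative D) (at t)"
proof -
  obtain D0 where D0: "((\<lambda>k. bessel_kernel b k x) has_real_derivative D0) (at (a * t))"
    using bessel_kernel_differentiable[OF b x] by auto
  have at: "0 < a * t" using a t by simp
  then have "a * t \<notin> \<int>\<^sub>\<le>\<^sub>0" by auto
  note G = Gamma_real_pos[OF at, THEN less_imp_neq]
  have 1: "((\<lambda>r. bessel_kernel b (a * r) x) has_real_derivative D0 * a) (at t)"
    by (rule DERIV_chain2[where g = "\<lambda>r. a * r", OF D0]) (auto intro!: derivative_eq_intros)
  have 2: "((\<lambda>r. Gamma (a * r)) has_real_derivative Gamma (a * t) * Digamma (a * t) * a) (at t)"
    by (rule DERIV_chain2[OF has_field_derivative_Gamma])
      (use \<open>a * t \<notin> \<int>\<^sub>\<le>\<^sub>0\<close> in \<open>auto intro!: derivative_eq_intros\<close>)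
  have 3: "((\<lambda>r. b powr (a * r)) has_real_derivative ln b * b powr (a * t) * a) (at t)"
    using b by (auto intro!: derivative_eq_intros)
  show thesis
    by (rule that, unfold vg_density_eq) (rule DERIV_mult[OF DERIV_cdivide[OF DERIV_divide[OF 3 2 G[symmetric]]] 1])
qed

text \<open>The limit below is the Levy density of the process.\<close>

lemma vg_density_small_time:
  assumes a: "0 < a" and b: "0 < b"
  obtains C where "0 \<le> C"
    and "\<And>e z. 0 < e \<Longrightarrow> a * e \<le> 1 \<Longrightarrow> z \<noteq> 0 \<Longrightarrow>
      vg_density a b e z / e \<le> C * (exp (- sqrt b * \<bar>z\<bar>) / \<bar>z\<bar> + vg_density a b (1 / a) z)"
    and "\<And>z. z \<noteq> 0 \<Longrightarrow> ((\<lambda>e. vg_density a b e z / e) \<longlongrightarrow> a * exp (- sqrt b * \<bar>z\<bar>) / \<bar>z\<bar>) (at_right 0)"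
proof -
  \<comment> \<open>The functional equation e Gamma(a e) = Gamma(1 + a e) / a removes the
    indeterminate form at e = 0: the prefactor of \<open>vg_density\<close>, divided by e, extends
    continuously to exponent 0.\<close>
  define F where "F k = a * b powr k / Gamma (1 + k) / sqrt (4 * pi)" for k
  have F: "vg_density a b e z / e = F (a * e) * bessel_kernel b (a * e) z" if e: "0 < e" for e z
  proof -
    have "0 < a * e" using a e by simp
    then have "a * e \<notin> \<int>\<^sub>\<le>\<^sub>0" by auto
    then have "Gamma (1 + a * e) = a * e * Gamma (a * e)"
      using Gamma_plus1[of "a * e"] by (simp add: add.commute)
    then show ?thesis using a e by (simp add: vg_density_eq F_def)
  qed
  have np: "1 + k \<notin> \<int>\<^sub>\<le>\<^sub>0" if "0 \<le> k" for k :: real using that by (auto elim!: nonpos_Ints_cases)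
  have Fc: "isCont F k" if "0 \<le> k" for k
    unfolding F_def using b np[OF that] Gamma_real_pos[of "1 + k", THEN less_imp_neq] that
    by (intro continuous_intros) auto
  then have "continuous_on {0..1} F" by (intro continuous_at_imp_continuous_on) auto
  then have "compact (F ` {0..1})" by (rule compact_continuous_image) simp
  then have "bounded (F ` {0..1})" by (rule compact_imp_bounded)
  then obtain M where "\<forall>k\<in>{0..1}. \<bar>F k\<bar> \<le> M"
    unfolding bounded_iff by auto
  then have M: "\<bar>F k\<bar> \<le> M" if "0 \<le> k" "k \<le> 1" for k using that by auto
  have M0: "0 \<le> M" using M[of 0] by auto
  \<comment> \<open>\<open>M\<close> bounds \<open>F\<close> on [0,1]; the two entries of the
    maximum convert the kernel at exponent 0 into the Levy density shape and the kernel at exponent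
    1 into the density at time 1/a.\<close>
  define C where "C = M * max (2 * sqrt pi) (sqrt (4 * pi) / b)"
  show thesis
  proof (rule that[of C])
    show "0 \<le> C"
      unfolding C_def using M0 by (intro mult_nonneg_nonneg) (auto simp: le_max_iff_disj)
    fix z :: real assume z: "z \<noteq> 0"
    {
      fix e :: real assume e: "0 < e" "a * e \<le> 1"
      have "0 \<le> a * e" using a e by simp
      have "vg_density a b e z / e \<le> M * (bessel_kernel b 0 z + bessel_kernel b 1 z)"
        unfolding F[OF e(1)] using M[OF \<open>0 \<le> a * e\<close> e(2)] bessel_kernel_le_add[OF b z \<open>0 \<le> a * e\<close> e(2)] M0
        by (intro mult_mono) auto
      also have "bessel_kernel b 1 z = sqrt (4 * pi) / b * vg_density a b (1 / a) z"
        using a b by (simp add: vg_density_eq)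
      also have "bessel_kernel b 0 z = 2 * sqrt pi * (exp (- sqrt b * \<bar>z\<bar>) / \<bar>z\<bar>)"
        using bessel_kernel_0[OF b z] by simp
      also have "M * (2 * sqrt pi * (exp (- sqrt b * \<bar>z\<bar>) / \<bar>z\<bar>) + sqrt (4 * pi) / b * vg_density a b (1 / a) z)
          \<le> M * (max (2 * sqrt pi) (sqrt (4 * pi) / b) * (exp (- sqrt b * \<bar>z\<bar>) / \<bar>z\<bar>) + max (2 * sqrt pi) (sqrt (4 * pi) / b) * vg_density a b (1 / a) z)"
        using M0 a by (intro mult_left_mono add_mono mult_right_mono vg_density_nonneg) auto
      finally show "vg_density a b e z / e \<le> C * (exp (- sqrt b * \<bar>z\<bar>) / \<bar>z\<bar> + vg_density a b (1 / a) z)"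
        by (simp only: C_def distrib_left mult.assoc)
    }
    show "((\<lambda>e. vg_density a b e z / e) \<longlongrightarrow> a * exp (- sqrt b * \<bar>z\<bar>) / \<bar>z\<bar>) (at_right 0)"
    proof -
      obtain D where "((\<lambda>k. bessel_kernel b k z) has_real_derivative D) (at 0)"
        using bessel_kernel_differentiable[OF b, of z 0] z by auto
      then have K0: "isCont (\<lambda>k. bessel_kernel b k z) 0" by (rule DERIV_isCont)
      have ae: "((\<lambda>e. a * e) \<longlongrightarrow> 0) (at_right 0)" by (auto intro!: tendsto_eq_intros)
      have "((\<lambda>e. F (a * e) * bessel_kernel b (a * e) z) \<longlongrightarrow> F 0 * bessel_kernel b 0 z) (at_right 0)"
        by (intro tendsto_mult isCont_tendsto_compose[OF Fc[OF order_refl]] isCont_tendsto_compose[OF K0] ae)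
      moreover have "\<forall>\<^sub>F e in at_right 0. F (a * e) * bessel_kernel b (a * e) z = vg_density a b e z / e"
        unfolding eventually_at_filter by (intro always_eventually) (simp add: F)
      ultimately have "((\<lambda>e. vg_density a b e z / e) \<longlongrightarrow> F 0 * bessel_kernel b 0 z) (at_right 0)"
        by (rule Lim_transform_eventually)
      also have "F 0 * bessel_kernel b 0 z = a * exp (- sqrt b * \<bar>z\<bar>) / \<bar>z\<bar>"
        using bessel_kernel_0[OF b z] b by (simp add: F_def real_sqrt_mult)
      finally show ?thesis .
    qed
  qed
qed

lemma vg_density_deriv_time:
  assumes a: "0 < a" and b: "0 < b" and t: "0 < t" and x: "x \<noteq> 0 \<or> 1/2 < a * t"
  shows "((\<lambda>r. vg_density a b r x) has_real_derivative
      (\<integral>z. (vg_density a b t (x - z) - vg_density a b t x) * (a * exp (- sqrt b * \<bar>z\<bar>) / \<bar>z\<bar>) \<partial>lborel)) (at t)"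
    (is "(_ has_real_derivative ?D) _")
proof -
  let ?p = "vg_density a b"
  let ?\<Delta> = "\<lambda>z. ?p t (x - z) - ?p t x"
  obtain D where D: "((\<lambda>r. ?p r x) has_real_derivative D) (at t)"
    using vg_density_differentiable_time[OF assms] by auto
  obtain C g d where Cg: "0 \<le> C" "0 < g" "g \<le> 1" "0 < d" "\<And>z. \<bar>z\<bar> \<le> d \<Longrightarrow> \<bar>?\<Delta> z\<bar> \<le> C * \<bar>z\<bar> powr g"
    by (rule vg_density_hoelder[OF assms], rule that)
  obtain K where K: "0 \<le> K"
      "\<And>e z. 0 < e \<Longrightarrow> a * e \<le> 1 \<Longrightarrow> z \<noteq> 0 \<Longrightarrow> ?p e z / e \<le> K * (exp (- sqrt b * \<bar>z\<bar>) / \<bar>z\<bar> + ?p (1 / a) z)"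
      "\<And>z. z \<noteq> 0 \<Longrightarrow> ((\<lambda>e. ?p e z / e) \<longlongrightarrow> a * exp (- sqrt b * \<bar>z\<bar>) / \<bar>z\<bar>) (at_right 0)"
    by (rule vg_density_small_time[OF a b], rule that)
  have conv: "integrable lborel (\<lambda>z. ?\<Delta> z * ?p e z)" "(\<integral>z. ?\<Delta> z * ?p e z \<partial>lborel) = ?p (t + e) x - ?p t x" if e: "0 < e" for e
  proof -
    \<comment> \<open>Finiteness at the origin persists as time increases, so forward increments are
      always available.\<close>
    have "x \<noteq> 0 \<or> 1/2 < a * (t + e)"
    proof (cases "x = 0")
      case True
      moreover have "a * t \<le> a * (t + e)" using a e by simp
      ultimately show ?thesis using x by linarith
    qed simp
    note c = vg_density_convolution[OF a b t e this, unfolded has_bochner_integral_iff]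
    note i = vg_density_integrable[OF a b e]
    show "integrable lborel (\<lambda>z. ?\<Delta> z * ?p e z)"
      unfolding left_diff_distrib by (intro Bochner_Integration.integrable_diff integrable_mult_right) (use c i in auto)
    show "(\<integral>z. ?\<Delta> z * ?p e z \<partial>lborel) = ?p (t + e) x - ?p t x"
      unfolding left_diff_distrib
      by (subst Bochner_Integration.integral_diff) (use c i in auto)
  qed
  \<comment> \<open>Below 1/a the exponent a e stays in [0,1], the range of the uniform small-time
    bound.\<close>
  let ?A = "{0<..<1 / a}"
  have right: "at 0 within ?A = at_right 0"
    by (rule at_within_nhd[of 0 "{..<1 / a}"]) (use a in auto)
  have "((\<lambda>e. \<integral>z. ?\<Delta> z * (?p e z / e) \<partial>lborel) \<longlongrightarrow> ?D) (at 0 within ?A)"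
  proof (rule integral_dominated_convergence_at[where w = "\<lambda>z. K * (\<bar>?\<Delta> z * (exp (- sqrt b * \<bar>z\<bar>) / \<bar>z\<bar>)\<bar> + \<bar>?\<Delta> z * ?p (1 / a) z\<bar>)"])
    show "integrable lborel (\<lambda>z. K * (\<bar>?\<Delta> z * (exp (- sqrt b * \<bar>z\<bar>) / \<bar>z\<bar>)\<bar> + \<bar>?\<Delta> z * ?p (1 / a) z\<bar>))"
      using hoelder_quotient_integrable[OF vg_density_integrable(1)[OF a b t] _ Cg(1,2,4,5), of "sqrt b"] conv(1)[of "1 / a"] a b
      by (intro integrable_mult_right Bochner_Integration.integrable_add Bochner_Integration.integrable_abs) auto
    show "AE z in lborel. ((\<lambda>e. ?\<Delta> z * (?p e z / e)) \<longlongrightarrow> ?\<Delta> z * (a * exp (- sqrt b * \<bar>z\<bar>) / \<bar>z\<bar>)) (at 0 within ?A)"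
      unfolding right using AE_lborel_singleton[of 0]
      by eventually_elim (intro tendsto_mult tendsto_const K(3))
    fix e assume "e \<in> ?A"
    then have e: "0 < e" "a * e \<le> 1" using a by (auto simp: field_simps)
    show "AE z in lborel. norm (?\<Delta> z * (?p e z / e)) \<le> K * (\<bar>?\<Delta> z * (exp (- sqrt b * \<bar>z\<bar>) / \<bar>z\<bar>)\<bar> + \<bar>?\<Delta> z * ?p (1 / a) z\<bar>)"
      using AE_lborel_singleton[of 0]
    proof eventually_elim
      case (elim z)
      have pos: "0 \<le> ?p e z / e" "0 \<le> ?p (1 / a) z" using a e by (auto intro!: divide_nonneg_nonneg vg_density_nonneg)
      have "norm (?\<Delta> z * (?p e z / e)) = \<bar>?\<Delta> z\<bar> * (?p e z / e)"
        unfolding real_norm_def abs_mult abs_of_nonneg[OF pos(1)] ..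
      also have "\<dots> \<le> \<bar>?\<Delta> z\<bar> * (K * (exp (- sqrt b * \<bar>z\<bar>) / \<bar>z\<bar> + ?p (1 / a) z))"
        using K(2)[OF e elim] by (intro mult_left_mono) auto
      also have "\<dots> = K * (\<bar>?\<Delta> z\<bar> * (exp (- sqrt b * \<bar>z\<bar>) / \<bar>z\<bar>) + \<bar>?\<Delta> z\<bar> * ?p (1 / a) z)"
        by (simp add: algebra_simps)
      finally show ?case
        using pos by (simp add: abs_mult)
    qed
  qed measurable
  then have "((\<lambda>e. \<integral>z. ?\<Delta> z * (?p e z / e) \<partial>lborel) \<longlongrightarrow> ?D) (at_right 0)"
    unfolding right .
  moreover have "\<forall>\<^sub>F e in at_right 0. (\<integral>z. ?\<Delta> z * (?p e z / e) \<partial>lborel) = (?p (t + e) x - ?p t x) / e"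
    unfolding eventually_at_filter using conv(2) by (intro always_eventually) auto
  ultimately have 1: "((\<lambda>e. (?p (t + e) x - ?p t x) / e) \<longlongrightarrow> ?D) (at_right 0)"
    by (rule Lim_transform_eventually)
  have "((\<lambda>e. (?p (t + e) x - ?p t x) / e) \<longlongrightarrow> D) (at_right 0)"
    using D unfolding DERIV_def by (rule tendsto_within_subset) simp
  then have "D = ?D"
    using tendsto_unique[OF trivial_limit_at_right_real] 1 by blast
  with D show ?thesis by simp
qed

lemma integral_split_sign:
  fixes f :: "real \<Rightarrow> real"
  assumes f: "integrable lborel f"
  shows "integral\<^sup>L lborel f = (\<integral>z. indicator {0<..} z * f z \<partial>lborel) + (\<integral>z. indicator {0<..} z * f (- z) \<partial>lborel)"
proof -
  let ?g = "\<lambda>z. indicator {0<..} z * f z" and ?h = "\<lambda>z. indicator {..<0} z * f z"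
  have g: "integrable lborel ?g" and h: "integrable lborel ?h"
    using integrable_mult_indicator[OF _ f, of "{0<..}"] integrable_mult_indicator[OF _ f, of "{..<0}"]
    by (simp_all only: real_scaleR_def) simp_all
  have "integral\<^sup>L lborel f = (\<integral>z. ?g z + ?h z \<partial>lborel)"
    by (rule integral_cong_AE)
      (use f g h AE_lborel_singleton[of 0] in \<open>auto elim!: eventually_mono simp: indicator_def\<close>)
  also have "\<dots> = integral\<^sup>L lborel ?g + integral\<^sup>L lborel ?h"
    using g h by (rule Bochner_Integration.integral_add)
  also have "integral\<^sup>L lborel ?h = (\<integral>z. ?h (0 + (- 1) * z) \<partial>lborel)"
    using lborel_integral_real_affine[of "-1" ?h 0] by simp
  also have "\<dots> = (\<integral>z. indicator {0<..} z * f (- z) \<partial>lborel)"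
    by (intro Bochner_Integration.integral_cong) (auto simp: indicator_def)
  finally show ?thesis .
qed

text \<open>The integral in \<open>vg_density_deriv_time\<close> splits at z = 0. Its right half is
  minus the Marchaud form \<open>I\<close> at x, which is the derivative of the plus integral. By
  evenness its left half is minus \<open>I\<close> at -x; the chain rule for y to -y and the sign in
  the definition of the minus operator identify \<open>I (- x)\<close> with that operator at
  x.\<close>

lemma vg_density_equation:
  assumes a: "0 < a" and b: "0 < b" and t: "0 < t" and x: "x \<noteq> 0 \<or> 1/2 < a * t"
  defines "u \<equiv> vg_density a b t"
  shows "weyl_integral_plus a (sqrt b) u field_differentiable (at x)"
    and "weyl_integral_minus a (sqrt b) u field_differentiable (at x)"
    and "((\<lambda>r. vg_density a b r x) has_real_derivative
             - (weyl_deriv_plus a (sqrt b) u x + weyl_deriv_minus a (sqrt b) u x)) (at t)"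
proof -
  have sb: "0 < sqrt b" using b by simp
  have ui: "integrable lborel u" unfolding u_def by (rule vg_density_integrable(1)[OF a b t])
  have ue: "u (- s) = u s" for s by (simp add: u_def)
  define I where "I y = (\<integral>z. indicator {0<..} z * ((u y - u (y - z)) * (a * exp (- sqrt b * z) / z)) \<partial>lborel)" for y
  have plus: "(weyl_integral_plus a (sqrt b) u has_real_derivative I y) (at y)" if y: "y \<noteq> 0 \<or> 1/2 < a * t" for y
  proof -
    obtain C g d where C: "0 \<le> C" "0 < g" "g \<le> 1" "0 < d" "\<And>z. \<bar>z\<bar> \<le> d \<Longrightarrow> \<bar>u (y - z) - u y\<bar> \<le> C * \<bar>z\<bar> powr g"
      by (rule vg_density_hoelder[OF a b t y, folded u_def], rule that)
    show ?thesis
      unfolding I_def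
      by (rule weyl_integral_plus_deriv[OF a sb ui _ C]) (use vg_density_weyl_domain[OF a b t] in \<open>simp add: u_def\<close>)
  qed
  have "((\<lambda>y. weyl_integral_plus a (sqrt b) u (- y)) has_real_derivative I (- x) * (- 1)) (at x)"
    using x by (intro DERIV_chain2[OF plus] derivative_eq_intros) auto
  then have minus: "(weyl_integral_minus a (sqrt b) u has_real_derivative - I (- x)) (at x)"
    unfolding weyl_minus_even(2)[of u, OF ue, abs_def] by simp
  show "weyl_integral_plus a (sqrt b) u field_differentiable (at x)" "weyl_integral_minus a (sqrt b) u field_differentiable (at x)"
    using plus[OF x] minus by (auto simp: field_differentiable_def)
  obtain C g d where C: "0 \<le> C" "0 < g" "g \<le> 1" "0 < d" "\<And>z. \<bar>z\<bar> \<le> d \<Longrightarrow> \<bar>u (x - z) - u x\<bar> \<le> C * \<bar>z\<bar> powr g"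
    by (rule vg_density_hoelder[OF a b t x, folded u_def], rule that)
  let ?f = "\<lambda>z. (u (x - z) - u x) * (a * exp (- sqrt b * \<bar>z\<bar>) / \<bar>z\<bar>)"
  have "integrable lborel (\<lambda>z. a * ((u (x - z) - u x) * (exp (- sqrt b * \<bar>z\<bar>) / \<bar>z\<bar>)))"
    using hoelder_quotient_integrable[OF ui sb C(1,2,4,5)] by (rule integrable_mult_right)
  then have "integrable lborel ?f" by (simp add: mult_ac)
  then have "integral\<^sup>L lborel ?f = (\<integral>z. indicator {0<..} z * ?f z \<partial>lborel) + (\<integral>z. indicator {0<..} z * ?f (- z) \<partial>lborel)"
    by (rule integral_split_sign)
  also have "(\<integral>z. indicator {0<..} z * ?f z \<partial>lborel) = - I x"
    unfolding I_def Bochner_Integration.integral_minus[symmetric]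
    by (intro Bochner_Integration.integral_cong) (auto simp: indicator_def divide_inverse algebra_simps)
  also have "(\<integral>z. indicator {0<..} z * ?f (- z) \<partial>lborel) = - I (- x)"
  proof -
    have e: "u (- x - z) = u (x + z)" for z using ue[of "x + z"] by simp
    show ?thesis
      unfolding I_def Bochner_Integration.integral_minus[symmetric] e ue
      by (intro Bochner_Integration.integral_cong) (auto simp: indicator_def divide_inverse algebra_simps)
  qed
  finally have "integral\<^sup>L lborel ?f = - (weyl_deriv_plus a (sqrt b) u x + weyl_deriv_minus a (sqrt b) u x)"
    using DERIV_imp_deriv[OF plus[OF x]] DERIV_imp_deriv[OF minus]
    by (simp add: weyl_deriv_plus_def weyl_deriv_minus_def)
  then show "((\<lambda>r. vg_density a b r x) has_real_derivative
             - (weyl_deriv_plus a (sqrt b) u x + weyl_deriv_minus a (sqrt b) u x)) (at t)"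
    using vg_density_deriv_time[OF a b t x] by (simp add: u_def)
qed

section \<open>The law of the process\<close>

lemma heat_kernel_char:
  assumes s: "0 < s"
  shows "(\<integral>x. heat_kernel s x *\<^sub>R iexp (u * x) \<partial>lborel) = complex_of_real (exp (- u\<^sup>2 * s))"
proof -
  define c where "c = sqrt (2 * s)"
  have c: "0 < c" "c\<^sup>2 = 2 * s" using s by (auto simp: c_def)
  have h: "c * heat_kernel s (c * y) = std_normal_density y" for y
    using s c by (simp add: heat_kernel_def std_normal_density_def power_mult_distrib real_sqrt_mult)
      (simp add: c_def real_sqrt_mult field_simps)
  have "(\<integral>x. heat_kernel s x *\<^sub>R iexp (u * x) \<partial>lborel)
      = c *\<^sub>R (\<integral>y. heat_kernel s (0 + c * y) *\<^sub>R iexp (u * (0 + c * y)) \<partial>lborel)"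
    using c by (subst lborel_integral_real_affine[where c = c and t = 0]) auto
  also have "\<dots> = (\<integral>y. (c * heat_kernel s (c * y)) *\<^sub>R iexp ((u * c) * y) \<partial>lborel)"
    by (simp add: mult.assoc flip: integral_scaleR_right)
  also have "\<dots> = char std_normal_distribution (u * c)"
    unfolding h char_def by (subst integral_density) auto
  also have "\<dots> = complex_of_real (exp (- u\<^sup>2 * s))"
    using c by (simp add: char_std_normal_distribution power_mult_distrib)
  finally show ?thesis .
qed

lemma vg_density_real_distribution:
  assumes "0 < a" "0 < b" "0 < t"
  shows "real_distribution (density lborel (\<lambda>x. ennreal (vg_density a b t x)))"
proof -
  have "(\<integral>\<^sup>+ x. ennreal (vg_density a b t x) \<partial>lborel) = 1"
    using vg_density_integrable[OF assms] vg_density_nonneg[OF assms(1,3)] by (subst nn_integral_eq_integral) auto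
  then have "prob_space (density lborel (\<lambda>x. ennreal (vg_density a b t x)))"
    by (intro prob_spaceI) (simp add: emeasure_density)
  then show ?thesis
    by (simp add: real_distribution_def real_distribution_axioms_def)
qed

text \<open>The absolute value of the double integrand has total mass 1, so Fubini applies. The heat
  kernel contributes exp(-u^2 s), and the remaining integral is the Laplace transform of the gamma
  density at u^2.\<close>

lemma vg_density_char:
  assumes a: "0 < a" and b: "0 < b" and t: "0 < t"
  shows "char (density lborel (\<lambda>x. ennreal (vg_density a b t x))) u = complex_of_real ((b / (b + u\<^sup>2)) powr (a * t))"
proof -
  let ?h = "gamma_subordinator_density a b t"
  let ?f = "\<lambda>x s. (heat_kernel s x * ?h s) *\<^sub>R iexp (u * x)"
  have h: "0 \<le> ?h s" "s \<le> 0 \<Longrightarrow> ?h s = 0" for s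
    using gamma_subordinator_density_nonneg[OF a t] by (auto simp: gamma_subordinator_density_def)
  have gh: "0 \<le> heat_kernel s x * ?h s" for s x
    using h[of s] by (cases "0 < s") (auto simp: heat_kernel_def)
  have nn: "vg_nn_density a b t x = (\<integral>\<^sup>+ s. ennreal (heat_kernel s x * ?h s) \<partial>lborel)" for x
    unfolding vg_nn_density_def by (intro nn_integral_cong) (simp add: ennreal_mult''[OF h(1)])
  have int: "integrable (lborel \<Otimes>\<^sub>M lborel) (\<lambda>(x, s). ?f x s)"
  proof (rule integrableI_bounded)
    have "(\<integral>\<^sup>+ z. ennreal (norm (case z of (x, s) \<Rightarrow> ?f x s)) \<partial>(lborel \<Otimes>\<^sub>M lborel))
        = (\<integral>\<^sup>+ z. ennreal (case z of (x, s) \<Rightarrow> heat_kernel s x * ?h s) \<partial>(lborel \<Otimes>\<^sub>M lborel))"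
      by (intro nn_integral_cong) (auto simp: gh abs_of_nonneg[OF gh] simp del: abs_mult)
    also have "\<dots> = (\<integral>\<^sup>+ x. (\<integral>\<^sup>+ s. ennreal (heat_kernel s x * ?h s) \<partial>lborel) \<partial>lborel)"
      by (subst lborel.nn_integral_fst[symmetric]) auto
    also have "\<dots> = 1"
      unfolding nn[symmetric] by (rule nn_integral_vg_nn_density[OF a b t])
    finally show "(\<integral>\<^sup>+ z. ennreal (norm (case z of (x, s) \<Rightarrow> ?f x s)) \<partial>(lborel \<Otimes>\<^sub>M lborel)) < \<infinity>" by simp
  qed measurable
  have "char (density lborel (\<lambda>x. ennreal (vg_density a b t x))) u = (\<integral>x. vg_density a b t x *\<^sub>R iexp (u * x) \<partial>lborel)"
    unfolding char_def using vg_density_nonneg[OF a t] by (subst integral_density) auto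
  also have "\<dots> = (\<integral>x. (\<integral>s. ?f x s \<partial>lborel) \<partial>lborel)"
  proof (rule Bochner_Integration.integral_cong)
    fix x
    have "vg_density a b t x = (\<integral>s. heat_kernel s x * ?h s \<partial>lborel)"
      unfolding vg_density_def set_lebesgue_integral_def
      by (intro Bochner_Integration.integral_cong) (auto simp: indicator_def h)
    then show "vg_density a b t x *\<^sub>R iexp (u * x) = (\<integral>s. ?f x s \<partial>lborel)"
      by (simp only: scaleR_conv_of_real integral_mult_left_zero integral_complex_of_real)
  qed simp
  also have "\<dots> = (\<integral>s. (\<integral>x. ?f x s \<partial>lborel) \<partial>lborel)"
    by (rule lborel_pair.Fubini_integral[OF int, symmetric])
  also have "\<dots> = (\<integral>s. complex_of_real (exp (- u\<^sup>2 * s) * ?h s) \<partial>lborel)"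
  proof (rule Bochner_Integration.integral_cong)
    fix s :: real
    show "(\<integral>x. ?f x s \<partial>lborel) = complex_of_real (exp (- u\<^sup>2 * s) * ?h s)"
    proof (cases "0 < s")
      case True
      have "(\<integral>x. ?f x s \<partial>lborel) = (\<integral>x. ?h s *\<^sub>R (heat_kernel s x *\<^sub>R iexp (u * x)) \<partial>lborel)"
        by (simp add: mult.commute)
      also have "\<dots> = ?h s *\<^sub>R complex_of_real (exp (- u\<^sup>2 * s))"
        by (simp only: integral_scaleR_right heat_kernel_char[OF True])
      finally show ?thesis by (simp add: scaleR_conv_of_real mult.commute)
    qed (simp add: h)
  qed simp
  also have "\<dots> = complex_of_real (\<integral>s. exp (- u\<^sup>2 * s) * ?h s \<partial>lborel)"
    by (rule integral_complex_of_real)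
  also have "(\<integral>s. exp (- u\<^sup>2 * s) * ?h s \<partial>lborel) = (b / (b + u\<^sup>2)) powr (a * t)"
    using gamma_subordinator_density_laplace[OF a b t, of "u\<^sup>2"] h by (subst integral_eq_nn_integral) auto
  finally show ?thesis .
qed

text \<open>The evaluation map \<open>(s, path) \<mapsto> path s\<close> is not measurable for the product \<open>\<sigma>\<close>-algebra on paths,
  so independence of the paths of \<open>H\<close> and \<open>B\<close> is exploited after rounding \<open>H t\<close> to finitely many
  values.\<close>

definition grid :: "nat \<Rightarrow> real \<Rightarrow> nat" where
  "grid n s = min (nat \<lfloor>real (Suc n) * s\<rfloor>) ((Suc n)\<^sup>2)"

lemma grid_le: "grid n s \<le> (Suc n)\<^sup>2"
  by (simp add: grid_def)

lemma grid_measurable [measurable]: "grid n \<in> measurable borel (count_space UNIV)"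
  unfolding grid_def by measurable

lemma grid_tendsto:
  assumes "0 \<le> s"
  shows "(\<lambda>n. real (grid n s) / real (Suc n)) \<longlonglongrightarrow> s"
proof (rule LIMSEQ_I)
  fix e :: real assume e: "0 < e"
  obtain N1 N2 :: nat where N: "1 / e < real N1" "s \<le> real N2"
    using reals_Archimedean2 real_arch_simple by meson
  show "\<exists>no. \<forall>n\<ge>no. norm (real (grid n s) / real (Suc n) - s) < e"
  proof (intro exI[of _ "max N1 N2"] allI impI)
    fix n assume n: "max N1 N2 \<le> n"
    define m where "m = real (Suc n)"
    have m: "0 < m" "s \<le> m" "1 / e < m" using n N by (auto simp: m_def)
    \<comment> \<open>The cap in \<open>grid\<close> sits at height Suc n after division by Suc n,
      so it is inactive once Suc n reaches \<open>s\<close>; from then on the rounding error is at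
      most 1 / Suc n.\<close>
    have "m * s \<le> m * m" using m by (intro mult_left_mono) auto
    then have "\<lfloor>m * s\<rfloor> \<le> \<lfloor>real ((Suc n)\<^sup>2)\<rfloor>"
      by (intro floor_mono) (simp only: m_def power2_eq_square of_nat_mult)
    then have "nat \<lfloor>m * s\<rfloor> \<le> (Suc n)\<^sup>2" by (simp only: floor_of_nat nat_le_iff)
    then have "grid n s = nat \<lfloor>m * s\<rfloor>" by (simp only: grid_def m_def min_absorb1)
    moreover have "0 \<le> m * s" using m assms by simp
    ultimately have g: "real (grid n s) = of_int \<lfloor>m * s\<rfloor>" by simp
    have "\<bar>of_int \<lfloor>m * s\<rfloor> - m * s\<bar> \<le> 1" by linarith
    moreover have "real (grid n s) / m - s = (of_int \<lfloor>m * s\<rfloor> - m * s) / m"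
      using m g by (simp add: field_simps)
    ultimately have "\<bar>real (grid n s) / m - s\<bar> \<le> 1 / m"
      using m by (simp add: abs_divide divide_right_mono)
    also have "\<dots> < e" using m e by (simp add: field_simps)
    finally show "norm (real (grid n s) / real (Suc n) - s) < e" by (simp add: m_def)
  qed
qed

context variance_gamma_process
begin

lemma H_nonneg: "\<omega> \<in> space M \<Longrightarrow> 0 \<le> t \<Longrightarrow> 0 \<le> H t \<omega>"
  using mono_onD[OF H.nondecreasing[of \<omega>], of 0 t] H.start_0[of \<omega>] by auto

lemma H_measurable: "0 \<le> t \<Longrightarrow> H t \<in> borel_measurable M"
  using H.rv by simp

lemma B_measurable: "0 \<le> t \<Longrightarrow> B t \<in> borel_measurable M"
  using B.rv by simp

text \<open>Continuity of every path of \<open>B\<close>. Besides approximating the law, this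
  exhibits \<open>X t\<close> as a pointwise limit of random variables, hence as measurable.\<close>

lemma X_approx:
  assumes t: "0 \<le> t" and w: "\<omega> \<in> space M"
  shows "(\<lambda>n. B (real (grid n (H t \<omega>)) / real (Suc n)) \<omega>) \<longlonglongrightarrow> X t \<omega>"
proof -
  from continuous_on_tendsto_compose[OF B.continuous_paths[OF w] grid_tendsto[OF H_nonneg[OF w t]]]
  show ?thesis
    unfolding subordinated[OF t w] using H_nonneg[OF w t] by simp
qed

text \<open>With s = H t each summand is a function of \<open>H t\<close> times a function of
  \<open>B\<close> at a deterministic time, the form in which measurability and independence can be
  applied.\<close>

lemma grid_sum:
  fixes f :: "real \<Rightarrow> 'b::real_vector"
  shows "f (B (real (grid n s) / real (Suc n)) \<omega>)
     = (\<Sum>k\<le>(Suc n)\<^sup>2. indicator {s. grid n s = k} s *\<^sub>R f (B (real k / real (Suc n)) \<omega>))"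
  using grid_le[of n s] by (subst sum.remove[of _ "grid n s"]) (auto simp: indicator_def intro!: sum.neutral)

lemma X_measurable:
  assumes t: "0 \<le> t"
  shows "X t \<in> borel_measurable M"
proof (rule borel_measurable_LIMSEQ_real)
  note [measurable] = H_measurable[OF t]
  show "(\<lambda>\<omega>. B (real (grid n (H t \<omega>)) / real (Suc n)) \<omega>) \<in> borel_measurable M" for n
  proof -
    have [measurable]: "B (real k / real (Suc n)) \<in> borel_measurable M" for k
      by (rule B_measurable) simp
    have "(\<lambda>\<omega>. \<Sum>k\<le>(Suc n)\<^sup>2. indicator {s. grid n s = k} (H t \<omega>) *\<^sub>R B (real k / real (Suc n)) \<omega>) \<in> borel_measurable M"
      by measurable
    then show ?thesis using grid_sum[of "\<lambda>x. x"] by simp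
  qed
qed (rule X_approx[OF t])

lemma indep_H_B:
  assumes "0 \<le> t" "0 \<le> s"
  shows "H.indep_var borel (H t) borel (B s)"
  using H.indep_var_compose[OF independent, of "\<lambda>f. f t" borel "\<lambda>f. f s" borel] assms
  by (simp add: comp_def)

lemma B_char:
  assumes "0 \<le> s"
  shows "(\<integral>\<omega>. iexp (u * B s \<omega>) \<partial>M) = complex_of_real (exp (- u\<^sup>2 * s))"
proof (cases "s = 0")
  case True
  then have "(\<integral>\<omega>. iexp (u * B s \<omega>) \<partial>M) = (\<integral>\<omega>. 1 \<partial>M)"
    using B.start_0 by (intro Bochner_Integration.integral_cong) auto
  then show ?thesis using True by (simp add: H.prob_space)
next
  case False
  then have s: "0 < s" using assms by simp
  note [measurable] = B_measurable[OF assms]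
  have "(\<integral>\<omega>. iexp (u * B s \<omega>) \<partial>M) = (\<integral>x. iexp (u * x) \<partial>distr M lborel (B s))"
    by (subst integral_distr) auto
  also have "\<dots> = (\<integral>x. iexp (u * x) \<partial>density lborel (\<lambda>x. ennreal (heat_kernel s x)))"
    using distributed_distr_eq_density[OF B.gaussian[OF s]] by simp
  also have "\<dots> = (\<integral>x. heat_kernel s x *\<^sub>R iexp (u * x) \<partial>lborel)"
    using s by (subst integral_density) (auto simp: heat_kernel_def)
  finally show ?thesis using heat_kernel_char[OF s] by simp
qed

text \<open>For the rounded time, independence factors each term of the grid sum, and
  \<open>B_char\<close> replaces the factor from \<open>B\<close> by exp(-u^2 k / Suc n); the sum
  then reassembles to the expectation for the rounded \<open>H t\<close>. Both sides pass to the
  limit with dominating function 1, the exponents on the right being nonpositive.\<close>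

lemma X_char:
  assumes t: "0 < t"
  shows "(\<integral>\<omega>. iexp (u * X t \<omega>) \<partial>M) = complex_of_real (\<integral>\<omega>. exp (- u\<^sup>2 * H t \<omega>) \<partial>M)"
proof -
  have t0: "0 \<le> t" using t by simp
  note [measurable] = H_measurable[OF t0] X_measurable[OF t0]
  let ?m = "\<lambda>n. real (Suc n)"
  let ?S = "\<lambda>n \<omega>. real (grid n (H t \<omega>)) / ?m n"
  have Bm[measurable]: "B (real k / ?m n) \<in> borel_measurable M" for k n by (rule B_measurable) simp
  let ?I = "\<lambda>n k s. indicator {s. grid n s = k} s :: real"
  have eq: "(\<integral>\<omega>. iexp (u * B (?S n \<omega>) \<omega>) \<partial>M) = complex_of_real (\<integral>\<omega>. exp (- u\<^sup>2 * ?S n \<omega>) \<partial>M)" for n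
  proof -
    have i1: "integrable M (\<lambda>\<omega>. complex_of_real (?I n k (H t \<omega>)))" for k
      by (rule H.integrable_const_bound[where B = 1]) (auto simp: indicator_def)
    have i2: "integrable M (\<lambda>\<omega>. iexp (u * B (real k / ?m n) \<omega>))" for k
      by (rule H.integrable_const_bound[where B = 1], simp, measurable)
    have i3: "integrable M (\<lambda>\<omega>. ?I n k (H t \<omega>))" for k
      by (rule H.integrable_const_bound[where B = 1]) (auto simp: indicator_def)
    have ind: "H.indep_var borel (\<lambda>\<omega>. complex_of_real (?I n k (H t \<omega>))) borel (\<lambda>\<omega>. iexp (u * B (real k / ?m n) \<omega>))" for k
      using H.indep_var_compose[OF indep_H_B[OF t0, of "real k / ?m n"], of "\<lambda>s. complex_of_real (?I n k s)" borel "\<lambda>x. iexp (u * x)" borel]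
      by (simp add: comp_def)
    have "(\<integral>\<omega>. iexp (u * B (?S n \<omega>) \<omega>) \<partial>M) =
        (\<integral>\<omega>. (\<Sum>k\<le>(Suc n)\<^sup>2. complex_of_real (?I n k (H t \<omega>)) * iexp (u * B (real k / ?m n) \<omega>)) \<partial>M)"
      unfolding grid_sum[of "\<lambda>x. iexp (u * x)"] scaleR_conv_of_real ..
    also have "\<dots> = (\<Sum>k\<le>(Suc n)\<^sup>2. (\<integral>\<omega>. complex_of_real (?I n k (H t \<omega>)) * iexp (u * B (real k / ?m n) \<omega>) \<partial>M))"
      by (rule Bochner_Integration.integral_sum) (rule H.indep_var_integrable[OF ind i1 i2])
    also have "\<dots> = (\<Sum>k\<le>(Suc n)\<^sup>2. complex_of_real (\<integral>\<omega>. ?I n k (H t \<omega>) * exp (- u\<^sup>2 * (real k / ?m n)) \<partial>M))"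
    proof (rule sum.cong)
      fix k
      have "(\<integral>\<omega>. complex_of_real (?I n k (H t \<omega>)) * iexp (u * B (real k / ?m n) \<omega>) \<partial>M)
         = (\<integral>\<omega>. complex_of_real (?I n k (H t \<omega>)) \<partial>M) * complex_of_real (exp (- u\<^sup>2 * (real k / ?m n)))"
        unfolding H.indep_var_lebesgue_integral[OF ind i1 i2] by (subst B_char) auto
      then show "(\<integral>\<omega>. complex_of_real (?I n k (H t \<omega>)) * iexp (u * B (real k / ?m n) \<omega>) \<partial>M)
         = complex_of_real (\<integral>\<omega>. ?I n k (H t \<omega>) * exp (- u\<^sup>2 * (real k / ?m n)) \<partial>M)"
        by (simp only: integral_complex_of_real integral_mult_left_zero of_real_mult)
    qed simp
    also have "\<dots> = complex_of_real (\<integral>\<omega>. (\<Sum>k\<le>(Suc n)\<^sup>2. ?I n k (H t \<omega>) * exp (- u\<^sup>2 * (real k / ?m n))) \<partial>M)"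
      unfolding of_real_sum[symmetric]
      by (subst Bochner_Integration.integral_sum) (auto intro: i3 simp: integrable_mult_left)
    also have "(\<integral>\<omega>. (\<Sum>k\<le>(Suc n)\<^sup>2. ?I n k (H t \<omega>) * exp (- u\<^sup>2 * (real k / ?m n))) \<partial>M) = (\<integral>\<omega>. exp (- u\<^sup>2 * ?S n \<omega>) \<partial>M)"
    proof (rule Bochner_Integration.integral_cong)
      fix \<omega>
      show "(\<Sum>k\<le>(Suc n)\<^sup>2. ?I n k (H t \<omega>) * exp (- u\<^sup>2 * (real k / ?m n))) = exp (- u\<^sup>2 * ?S n \<omega>)"
        using grid_le[of n "H t \<omega>"] by (subst sum.remove[of _ "grid n (H t \<omega>)"]) (auto simp: indicator_def intro!: sum.neutral)
    qed simp
    finally show ?thesis .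
  qed
  have "(\<lambda>n. \<integral>\<omega>. iexp (u * B (?S n \<omega>) \<omega>) \<partial>M) \<longlonglongrightarrow> (\<integral>\<omega>. iexp (u * X t \<omega>) \<partial>M)"
  proof (rule integral_dominated_convergence[where w = "\<lambda>_. 1"])
    show "AE \<omega> in M. (\<lambda>n. iexp (u * B (?S n \<omega>) \<omega>)) \<longlonglongrightarrow> iexp (u * X t \<omega>)"
      by (intro AE_I2 tendsto_intros X_approx[OF t0])
    show "(\<lambda>\<omega>. iexp (u * B (?S n \<omega>) \<omega>)) \<in> borel_measurable M" for n
      unfolding grid_sum[of "\<lambda>x. iexp (u * x)"] by measurable
  qed auto
  moreover have "(\<lambda>n. complex_of_real (\<integral>\<omega>. exp (- u\<^sup>2 * ?S n \<omega>) \<partial>M)) \<longlonglongrightarrow> complex_of_real (\<integral>\<omega>. exp (- u\<^sup>2 * H t \<omega>) \<partial>M)"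
  proof (intro tendsto_of_real integral_dominated_convergence[where w = "\<lambda>_. 1"])
    show "AE \<omega> in M. (\<lambda>n. exp (- u\<^sup>2 * ?S n \<omega>)) \<longlonglongrightarrow> exp (- u\<^sup>2 * H t \<omega>)"
      by (intro AE_I2 tendsto_intros grid_tendsto H_nonneg t0)
  qed auto
  ultimately show ?thesis
    unfolding eq by (rule LIMSEQ_unique)
qed

lemma X_distributed:
  assumes a: "0 < a" and b: "0 < b" and t: "0 < t"
  shows "distributed M lborel (X t) (\<lambda>x. ennreal (vg_density a b t x))"
proof -
  have t0: "0 \<le> t" using t by simp
  note [measurable] = X_measurable[OF t0]
  let ?D = "density lborel (\<lambda>x. ennreal (vg_density a b t x))"
  have "char (distr M borel (X t)) u = char ?D u" for u
  proof -
    \<comment> \<open>The Laplace transform is given for positive arguments, so u = 0 is treated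
      apart, where both sides are 1.\<close>
    have "(\<integral>\<omega>. exp (- u\<^sup>2 * H t \<omega>) \<partial>M) = (b / (b + u\<^sup>2)) powr (a * t)"
    proof (cases "u = 0")
      case False
      have "1 + u\<^sup>2 / b = (b + u\<^sup>2) / b" using b by (simp add: field_simps)
      moreover have "0 < b + u\<^sup>2" using b by (simp add: add_pos_nonneg)
      ultimately have "- t * (a * ln (1 + u\<^sup>2 / b)) = a * t * ln (b / (b + u\<^sup>2))"
        using b by (simp add: ln_div algebra_simps)
      moreover have "(\<integral>\<omega>. exp (- u\<^sup>2 * H t \<omega>) \<partial>M) = exp (- t * (a * ln (1 + u\<^sup>2 / b)))"
        using False by (intro H.laplace_transform) (auto simp: t0)
      ultimately show ?thesis
        using b \<open>0 < b + u\<^sup>2\<close> by (simp add: powr_def)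
    qed (use b in \<open>simp add: H.prob_space\<close>)
    then show ?thesis
      unfolding vg_density_char[OF a b t] using X_char[OF t, of u] by (simp add: char_def integral_distr)
  qed
  then have "distr M borel (X t) = ?D"
    by (intro Levy_uniqueness vg_density_real_distribution a b t H.real_distribution_distr) auto
  then show ?thesis
    unfolding distributed_def by (simp cong: distr_cong)
qed

section \<open>The initial condition\<close>

lemma X_0: "distr M borel (X 0) = return borel 0"
proof -
  have "X 0 \<omega> = 0" if "\<omega> \<in> space M" for \<omega>
    using subordinated[of 0 \<omega>] H.start_0 B.start_0 that by simp
  then have "distr M borel (X 0) = distr M borel (\<lambda>_. 0)"
    by (intro distr_cong) auto
  also have "\<dots> = return borel 0"
    by (simp add: H.distr_const)
  finally show ?thesis .
qed

text \<open>\<open>H\<close> is right continuous at 0 and \<open>B\<close> is continuous, both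
  starting at 0.\<close>

lemma X_tendsto_0:
  assumes w: "\<omega> \<in> space M"
  shows "((\<lambda>t. X t \<omega>) \<longlongrightarrow> 0) (at_right 0)"
proof -
  have "((\<lambda>t. H t \<omega>) \<longlongrightarrow> 0) (at_right 0)"
    using H.right_continuous[OF w, of 0] H.start_0[OF w] by (simp add: continuous_within)
  then have "((\<lambda>t. B (H t \<omega>) \<omega>) \<longlongrightarrow> B 0 \<omega>) (at_right 0)"
    using continuous_on_tendsto_compose[OF B.continuous_paths[OF w], of "\<lambda>t. H t \<omega>" 0 "at_right 0"] H_nonneg[OF w]
    by (auto simp: eventually_at_filter)
  moreover have "\<forall>\<^sub>F t in at_right 0. B (H t \<omega>) \<omega> = X t \<omega>"
    unfolding eventually_at_filter using subordinated w by (intro always_eventually) auto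
  ultimately show ?thesis
    using B.start_0[OF w] Lim_transform_eventually by fastforce
qed

text \<open>Convergence to the Dirac mass is obtained from the paths: f(X t) tends to f(0)
  boundedly, and the expectation is the integral against the density. No estimate on the formula for
  the density enters.\<close>

lemma vg_density_initial:
  fixes f :: "real \<Rightarrow> real"
  assumes a: "0 < a" and b: "0 < b" and f: "continuous_on UNIV f" "bounded (range f)"
  shows "((\<lambda>t. LINT x|lborel. f x * vg_density a b t x) \<longlongrightarrow> f 0) (at_right 0)"
proof -
  have [measurable]: "f \<in> borel_measurable borel" by (rule borel_measurable_continuous_onI[OF f(1)])
  obtain K where K: "\<And>x. \<bar>f x\<bar> \<le> K" using f(2) by (auto simp: bounded_iff)
  have "((\<lambda>t. \<integral>\<omega>. f (X t \<omega>) \<partial>M) \<longlongrightarrow> (\<integral>\<omega>. f 0 \<partial>M)) (at_right 0)"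
  proof (rule integral_dominated_convergence_at[where w = "\<lambda>_. K"])
    show "AE \<omega> in M. ((\<lambda>t. f (X t \<omega>)) \<longlongrightarrow> f 0) (at_right 0)"
      using f(1) by (intro AE_I2 isCont_tendsto_compose[OF _ X_tendsto_0]) (auto simp: continuous_on_eq_continuous_at)
    fix t :: real assume "t \<in> {0<..}"
    then have [measurable]: "X t \<in> borel_measurable M" by (intro X_measurable) auto
    show "(\<lambda>\<omega>. f (X t \<omega>)) \<in> borel_measurable M" by measurable
  qed (use K in auto)
  moreover have "\<forall>\<^sub>F t in at_right 0. (\<integral>\<omega>. f (X t \<omega>) \<partial>M) = (LINT x|lborel. f x * vg_density a b t x)"
    unfolding eventually_at_filter
  proof (intro always_eventually allI impI)
    fix t :: real assume "t \<in> {0<..}"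
    then have t: "0 < t" by simp
    have "(\<integral>\<omega>. f (X t \<omega>) \<partial>M) = (\<integral>x. vg_density a b t x * f x \<partial>lborel)"
      by (rule distributed_integral[OF X_distributed[OF a b t], symmetric]) (auto simp: vg_density_nonneg a t)
    then show "(\<integral>\<omega>. f (X t \<omega>) \<partial>M) = (LINT x|lborel. f x * vg_density a b t x)"
      by (simp add: mult.commute)
  qed
  ultimately show ?thesis
    using Lim_transform_eventually by (fastforce simp: H.prob_space)
qed

end

theorem theorem3p1:
  fixes a b :: real
    and M :: "'w measure"
    and H B X :: "real \<Rightarrow> 'w \<Rightarrow> real"
    and p :: "real \<Rightarrow> real \<Rightarrow> real"
  defines "p \<equiv> vg_density a b"
  assumes a: "a > 0" and b: "b > 0"
    and X: "variance_gamma_process a b M H B X"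
  shows
    \<comment> \<open>\<open>p\<close> is the density of \<open>X\<close>\<close>
    "(\<forall>t>0. distributed M lborel (X t) (\<lambda>x. ennreal (p t x)))
    \<comment> \<open>the operators are applicable to \<open>p t\<close>\<close>
    \<and> (\<forall>t>0. weyl_domain_plus a (sqrt b) (p t) \<and> weyl_domain_minus a (sqrt b) (p t))
    \<comment> \<open>the equation, wherever the density is finite\<close>
    \<and> (\<forall>t>0. \<forall>x. vg_density_finite a b t x \<longrightarrow>
          weyl_integral_plus a (sqrt b) (p t) field_differentiable (at x)
        \<and> weyl_integral_minus a (sqrt b) (p t) field_differentiable (at x)
        \<and> ((\<lambda>r. p r x) has_real_derivative
             - (weyl_deriv_plus a (sqrt b) (p t) x + weyl_deriv_minus a (sqrt b) (p t) x)) (at t))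
    \<comment> \<open>initial condition: the law of \<open>X 0\<close> is \<open>\<delta>\<close>, and \<open>p t\<close> tends to \<open>\<delta>\<close> as \<open>t\<close> decreases to 0\<close>
    \<and> distr M borel (X 0) = return borel 0
    \<and> (\<forall>f :: real \<Rightarrow> real. continuous_on UNIV f \<longrightarrow> bounded (range f) \<longrightarrow>
          ((\<lambda>t. LINT x|lborel. f x * p t x) \<longlongrightarrow> f 0) (at_right 0))"
proof -
  interpret variance_gamma_process a b M H B X by (rule X)
  show ?thesis
    unfolding p_def
  proof (intro conjI allI impI)
    fix t :: real assume t: "0 < t"
    show "distributed M lborel (X t) (\<lambda>x. ennreal (vg_density a b t x))"
      by (rule X_distributed[OF a b t])
    show "weyl_domain_plus a (sqrt b) (vg_density a b t)"
      by (rule vg_density_weyl_domain[OF a b t])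
    then show "weyl_domain_minus a (sqrt b) (vg_density a b t)"
      by (simp add: weyl_minus_even(1))
    fix x assume "vg_density_finite a b t x"
    then have "x \<noteq> 0 \<or> 1/2 < a * t" using vg_density_finite_iff[OF a b t] by simp
    note eq = vg_density_equation[OF a b t this]
    show "weyl_integral_plus a (sqrt b) (vg_density a b t) field_differentiable (at x)" by (rule eq(1))
    show "weyl_integral_minus a (sqrt b) (vg_density a b t) field_differentiable (at x)" by (rule eq(2))
    show "((\<lambda>r. vg_density a b r x) has_real_derivative
        - (weyl_deriv_plus a (sqrt b) (vg_density a b t) x + weyl_deriv_minus a (sqrt b) (vg_density a b t) x)) (at t)"
      by (rule eq(3))
  next
    show "distr M borel (X 0) = return borel 0" by (rule X_0)
  next
    fix f :: "real \<Rightarrow> real" assume "continuous_on UNIV f" "bounded (range f)"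
    then show "((\<lambda>t. LINT x|lborel. f x * vg_density a b t x) \<longlongrightarrow> f 0) (at_right 0)"
      by (rule vg_density_initial[OF a b])
  qed
qed

end
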